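(* Assume $\chi_{\rm res}\le\chi_0<1$ and $\gamma_h(k)>0$. For every $G\in V_h^\star$, $$C_{\rm syn}^{-1}\,\eta(G)\ \le\ \|G\|_{W_h^\star}\ \le\ C_{\rm sd}\,\eta(G).$$ Consequently, for a load $F\in V^\star$ with fine-grid Galerkin solution $u_h$, every $U\in V_h$ satisfies $$\eta_H(U)\le C_aC_{\rm syn}\|u_h-U\|_k .$$ Moreover, for every $z\in\mathcal N_H$ and $U\in V_h$, $\eta_{H,z}(U)\le C_{a,z}\|u_h-U\|_{k,N^2(z)}$, where $C_{a,z}$ is the local continuity constant.
   Context: **Problem.** $\Omega\subset\mathbb R^2$ is a bounded polygonal Lipschitz domain whose (fixed) boundary partition consists of relatively open parts $\Gamma_D,\Gamma_N,\Gamma_R$, disjoint up to endpoints, with $|\Gamma_R|>0$; $k\ge k_{\min}>0$. $V=\{v\in H^1(\Omega;\mathbb C): v|_{\Gamma_D}=0\}$. $L^2$ inner products are linear in the first and conjugate linear in the second argument. For $v,w\in V$, $$b_k(v,w)=(\nabla v,\nabla w)_\Omega+k^2(v,w)_\Omega,\quad \|v\|_k^2=b_k(v,v),\quad a(v,w)=(\nabla v,\nabla w)_\Omega-k^2(v,w)_\Omega-\mathrm i k(v,w)_{\Gamma_R}.$$ $\|v\|_{k,D}$ is the corresponding energy norm on $D\subseteq\Omega$. $C_a$ is a continuity constant: $|a(v,w)|\le C_a\|v\|_k\|w\|_k$ on $V$. For a subspace $X\subseteq V$, $X^\star$ is its continuous anti-dual, with $\|G\|_{X^\star}=\sup_{0\ne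 w\in X}|G(w)|/\|w\|_k$. **Meshes and patches.** $\mathcal T_H$ and its refinement $\mathcal T_h$ are shape-regular conforming triangular meshes resolving the boundary partition; $V_H\subseteq V_h\subset V$ are the associated continuous piecewise affine spaces; $H|_T=H_T=\operatorname{diam}T$ for $T\in\mathcal T_H$; $\mathcal N_H$ is the set of all coarse vertices (including Dirichlet vertices). For a coarse entity or a union of entities $S$: $N^0(S)=S$, $N(S)=\bigcup\{T\in\mathcal T_H:\overline T\cap\overline S\ne\varnothing\}$, $N^m(S)=N(N^{m-1}(S))$; $C_{\rm patch}(m)=\max_{T}\#\{K\in\mathcal T_H:K\subseteq N^m(T)\}$. **Quasi-interpolation and kernel.** $I_H=E_H\Pi_H^{\rm dg}:V\to V_H$, where $\Pi_H^{\rm dg}$ is the elementwise $L^2$ projection onto discontinuous piecewise affine functions and, for coarse vertices $z$, $(E_Hq)(z)=0$ if $z\in\overline{\Gamma_D}$ and $(E_Hq)(z)=\big(\sum_{T\ni z}q|_T(z)|T|\big)/\big(\sum_{T\ni z}|T|\big)$ otherwise; $I_H$ is a projection onto $V_H$. $C_{\rm app}$ is such that $H_T^{-1}\|v-I_Hv\|_{L^2(T)}\le C_{\rm app}\|\nabla v\|_{L^2(N(T))}$. $W_h=\ker I_H\cap V_h$, $\chi_{\rm res}=C_{\rm app}C_{\rm patch}(1)^{1/2}\|kH\|_{L^\infty(\Omega)}$. **Fine-grid problem.** $\gamma_h(k)=\inf_{0\ne v_h\in V_h}\sup_{0\ne w_h\in V_h}|a(v_h,w_h)|/(\|v_h\|_k\|w_h\|_k)$.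 For $F\in V^\star$, $u_h\in V_h$ solves $a(u_h,v_h)=F(v_h)$ for all $v_h\in V_h$. **Local spaces and constants.** For $z\in\mathcal N_H$, $W_{h,z}=\{w\in W_h:\operatorname{supp}w\subseteq\overline{N^2(z)}\}$. $C_{\rm sd},C_{\rm syn}$ are constants (depending only on $\chi_0$, coarse- and fine-mesh shape regularity and fixed-order patch overlap) such that every $w\in W_h$ can be written $w=\sum_{z}w_z$, $w_z\in W_{h,z}$, with $\sum_z\|w_z\|_k^2\le C_{\rm sd}^2\|w\|_k^2$, and such that arbitrary $w_z\in W_{h,z}$ satisfy $\|\sum_zw_z\|_k^2\le C_{\rm syn}^2\sum_z\|w_z\|_k^2$. All sums run over $z\in\mathcal N_H$. **Indicators.** For $G\in V_h^\star$, $\xi_z(G)\in W_{h,z}$ is defined by $b_k(\xi_z(G),w)=G(w)$ for all $w\in W_{h,z}$, and $\eta(G)^2=\sum_z\|\xi_z(G)\|_k^2$. For $U\in V_h$: $R_U=F-a(U,\cdot)$, $\eta_{H,z}(U)=\|\xi_z(R_U)\|_k$, $\eta_H(U)=\eta(R_U)$. **Local continuity constant.** $a_D$ denotes $a$ with the integrals restricted to $D$ (Robin integral over $\Gamma_R\cap\overline D$); $C_{a,z}$ is the continuity constant of $a_{N^2(z)}$ with respect to the norm $\|\cdot\|_{k,N^2(z)}$. *)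

theory Defs
  imports "HOL-Analysis.Analysis"
begin

text \<open>
  Elements of Lebesgue and Sobolev spaces on \<open>\<Omega>\<close> are represented by functions on the plane; only
  their values in \<open>\<Omega>\<close>, up to null sets, matter. Finite element functions are normalised to vanish
  outside \<open>closure \<Omega>\<close>, so for them equality of functions is equality in the space.
\<close>

type_synonym point = "real^2"
type_synonym cfun = "point \<Rightarrow> complex"

section \<open>The Sobolev space and boundary values\<close>

definition partial_deriv :: "2 \<Rightarrow> (point \<Rightarrow> real) \<Rightarrow> point \<Rightarrow> real" where
  "partial_deriv i \<phi> x = frechet_derivative \<phi> (at x) (axis i 1)"

definition test_function :: "point set \<Rightarrow> (point \<Rightarrow> real) \<Rightarrow> bool" where
  "test_function \<Omega> \<phi> \<longleftrightarrow>
     (\<forall>is. foldr partial_deriv is \<phi> differentiable_on UNIV) \<and>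
     compact (closure {x. \<phi> x \<noteq> 0}) \<and> closure {x. \<phi> x \<noteq> 0} \<subseteq> \<Omega>"

definition square_integrable_on :: "(point \<Rightarrow> 'a::euclidean_space) \<Rightarrow> point set \<Rightarrow> bool" where
  "square_integrable_on f D \<longleftrightarrow>
     set_borel_measurable lebesgue D f \<and> set_integrable lebesgue D (\<lambda>x. (norm (f x))\<^sup>2)"

definition is_weak_gradient :: "point set \<Rightarrow> cfun \<Rightarrow> (point \<Rightarrow> complex^2) \<Rightarrow> bool" where
  "is_weak_gradient \<Omega> v g \<longleftrightarrow>
     square_integrable_on g \<Omega> \<and>
     (\<forall>\<phi> i. test_function \<Omega> \<phi> \<longrightarrow>
        (LINT x:\<Omega>|lebesgue. partial_deriv i \<phi> x *\<^sub>R v x) = - (LINT x:\<Omega>|lebesgue. \<phi> x *\<^sub>R (g x $ i)))"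

definition H1 :: "point set \<Rightarrow> cfun set" where
  "H1 \<Omega> = {v. square_integrable_on v \<Omega> \<and> (\<exists>g. is_weak_gradient \<Omega> v g)}"

definition weak_grad :: "point set \<Rightarrow> cfun \<Rightarrow> point \<Rightarrow> complex^2" where
  "weak_grad \<Omega> v = (SOME g. is_weak_gradient \<Omega> v g)"

text \<open>Arc length on the boundary is the one-dimensional Hausdorff measure.\<close>

definition hausdorff1 :: "point set \<Rightarrow> ennreal" where
  "hausdorff1 A = (SUP \<delta>\<in>{0<..}.
     INF S\<in>{S :: nat \<Rightarrow> point set. A \<subseteq> (\<Union>i. S i) \<and> (\<forall>i. bounded (S i) \<and> diameter (S i) \<le> \<delta>)}.
       (\<Sum>i. ennreal (diameter (S i))))"

definition arc_measure :: "point measure" where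
  "arc_measure = measure_of UNIV (sets borel) hausdorff1"

text \<open>
  On a bounded Lipschitz domain the trace of an \<open>H1\<close> function is, at almost every boundary point, the
  limit of its mean values over small balls intersected with the domain (Evans--Gariepy,
  Measure Theory and Fine Properties of Functions, section 5.3). This fixes the trace without
  reference to an approximating sequence; for a function continuous on the closure it is the
  restriction to the boundary.
\<close>

definition boundary_trace :: "point set \<Rightarrow> cfun \<Rightarrow> cfun" where
  "boundary_trace \<Omega> v x =
     Lim (at_right 0) (\<lambda>r. (LINT y:(ball x r \<inter> \<Omega>)|lebesgue. v y) /\<^sub>R measure lebesgue (ball x r \<inter> \<Omega>))"

section \<open>Polygonal Lipschitz domains\<close>

definition lipschitz_domain :: "point set \<Rightarrow> bool" where
  "lipschitz_domain \<Omega> \<longleftrightarrow>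
     open \<Omega> \<and> connected \<Omega> \<and> \<Omega> \<noteq> {} \<and>
     (\<forall>p\<in>frontier \<Omega>. \<exists>e n \<gamma> L r h.
        norm e = 1 \<and> norm n = 1 \<and> e \<bullet> n = 0 \<and> r > 0 \<and> h > 0 \<and>
        L-lipschitz_on {-r<..<r} \<gamma> \<and> (\<forall>s\<in>{-r<..<r}. \<bar>\<gamma> s\<bar> < h) \<and>
        (\<forall>s\<in>{-r<..<r}. \<forall>t\<in>{-h<..<h}. p + s *\<^sub>R e + t *\<^sub>R n \<in> \<Omega> \<longleftrightarrow> \<gamma> s < t))"

definition polygonal :: "point set \<Rightarrow> bool" where
  "polygonal \<Omega> \<longleftrightarrow>
     (\<exists>S. finite S \<and> (\<forall>s\<in>S. \<exists>a b. s = closed_segment a b) \<and> frontier \<Omega> = \<Union>S)"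

definition boundary_partition :: "point set \<Rightarrow> point set \<Rightarrow> point set \<Rightarrow> point set \<Rightarrow> bool" where
  "boundary_partition \<Omega> D N R \<longleftrightarrow>
     (\<forall>\<Gamma>\<in>{D, N, R}. openin (top_of_set (frontier \<Omega>)) \<Gamma>) \<and>
     D \<inter> N = {} \<and> D \<inter> R = {} \<and> N \<inter> R = {} \<and>
     finite (closure D \<inter> closure N) \<and> finite (closure D \<inter> closure R) \<and> finite (closure N \<inter> closure R) \<and>
     frontier \<Omega> = closure D \<union> closure N \<union> closure R"

section \<open>Triangular meshes\<close>

text \<open>Mesh elements are open triangles.\<close>

definition open_triangle :: "point set \<Rightarrow> bool" where
  "open_triangle T \<longleftrightarrow> (\<exists>a b c. \<not> collinear {a, b, c} \<and> T = interior (convex hull {a, b, c}))"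

definition vertices :: "point set \<Rightarrow> point set" where
  "vertices T = {z. z extreme_point_of closure T}"

definition conforming_mesh :: "point set \<Rightarrow> point set set \<Rightarrow> bool" where
  "conforming_mesh \<Omega> \<T> \<longleftrightarrow>
     finite \<T> \<and> (\<forall>T\<in>\<T>. open_triangle T \<and> T \<subseteq> \<Omega>) \<and> (\<Union>T\<in>\<T>. closure T) = closure \<Omega> \<and>
     (\<forall>S\<in>\<T>. \<forall>T\<in>\<T>. closure S \<inter> closure T face_of closure S \<and> closure S \<inter> closure T face_of closure T)"

definition shape_regular :: "real \<Rightarrow> point set set \<Rightarrow> bool" where
  "shape_regular \<sigma> \<T> \<longleftrightarrow> (\<forall>T\<in>\<T>. diameter T \<le> \<sigma> * Sup {r. \<exists>x. ball x r \<subseteq> T})"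

definition resolves :: "point set set \<Rightarrow> point set \<Rightarrow> point set set \<Rightarrow> bool" where
  "resolves \<T> \<Omega> parts \<longleftrightarrow>
     (\<forall>T\<in>\<T>. \<forall>a\<in>vertices T. \<forall>b\<in>vertices T. a \<noteq> b \<longrightarrow> closed_segment a b \<subseteq> frontier \<Omega> \<longrightarrow>
        (\<exists>\<Gamma>\<in>parts. closed_segment a b \<subseteq> closure \<Gamma>))"

definition refines :: "point set set \<Rightarrow> point set set \<Rightarrow> bool" where
  "refines \<T>' \<T> \<longleftrightarrow> (\<forall>K\<in>\<T>'. \<exists>T\<in>\<T>. K \<subseteq> T)"

definition nodes :: "point set set \<Rightarrow> point set" where
  "nodes \<T> = (\<Union>T\<in>\<T>. vertices T)"

definition neighbourhood :: "point set set \<Rightarrow> point set \<Rightarrow> point set" where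
  "neighbourhood \<T> S = \<Union>{T\<in>\<T>. closure T \<inter> closure S \<noteq> {}}"

definition patch :: "point set set \<Rightarrow> nat \<Rightarrow> point set \<Rightarrow> point set" where
  "patch \<T> m S = (neighbourhood \<T> ^^ m) S"

definition C_patch :: "point set set \<Rightarrow> nat \<Rightarrow> nat" where
  "C_patch \<T> m = Max ((\<lambda>T. card {K\<in>\<T>. K \<subseteq> patch \<T> m T}) ` \<T>)"

definition affine_fun :: "cfun \<Rightarrow> bool" where
  "affine_fun p \<longleftrightarrow> (\<exists>c d\<^sub>1 d\<^sub>2. \<forall>x. p x = c + d\<^sub>1 * of_real (x $ 1) + d\<^sub>2 * of_real (x $ 2))"

definition P1 :: "point set \<Rightarrow> point set set \<Rightarrow> cfun set" where
  "P1 \<Omega> \<T> = {u. continuous_on (closure \<Omega>) u \<and> (\<forall>T\<in>\<T>. \<exists>p. affine_fun p \<and> (\<forall>x\<in>T. u x = p x)) \<and>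
     (\<forall>x. x \<notin> closure \<Omega> \<longrightarrow> u x = 0)}"

definition nodal_interpolant :: "point set \<Rightarrow> point set set \<Rightarrow> (point \<Rightarrow> complex) \<Rightarrow> cfun" where
  "nodal_interpolant \<Omega> \<T> c = (THE u. u \<in> P1 \<Omega> \<T> \<and> (\<forall>z\<in>nodes \<T>. u z = c z))"

definition L2_proj :: "point set \<Rightarrow> cfun \<Rightarrow> cfun" where
  "L2_proj T v =
     (THE p. affine_fun p \<and> (\<forall>q. affine_fun q \<longrightarrow> (LINT x:T|lebesgue. (v x - p x) * cnj (q x)) = 0))"

section \<open>The Helmholtz problem\<close>

record helmholtz_problem =
  Omega :: "point set"
  Gamma_D :: "point set"
  Gamma_N :: "point set"
  Gamma_R :: "point set"
  wavenumber :: real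
  coarse_mesh :: "point set set"
  fine_mesh :: "point set set"

definition helmholtz_setting :: "helmholtz_problem \<Rightarrow> real \<Rightarrow> real \<Rightarrow> real \<Rightarrow> bool" where
  "helmholtz_setting P k_min \<sigma>\<^sub>H \<sigma>\<^sub>h \<longleftrightarrow>
     bounded (Omega P) \<and> lipschitz_domain (Omega P) \<and> polygonal (Omega P) \<and>
     boundary_partition (Omega P) (Gamma_D P) (Gamma_N P) (Gamma_R P) \<and>
     emeasure arc_measure (Gamma_R P) > 0 \<and>
     0 < k_min \<and> k_min \<le> wavenumber P \<and>
     conforming_mesh (Omega P) (coarse_mesh P) \<and> shape_regular \<sigma>\<^sub>H (coarse_mesh P) \<and>
     resolves (coarse_mesh P) (Omega P) {Gamma_D P, Gamma_N P, Gamma_R P} \<and>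
     conforming_mesh (Omega P) (fine_mesh P) \<and> shape_regular \<sigma>\<^sub>h (fine_mesh P) \<and>
     resolves (fine_mesh P) (Omega P) {Gamma_D P, Gamma_N P, Gamma_R P} \<and>
     refines (fine_mesh P) (coarse_mesh P)"

definition V :: "helmholtz_problem \<Rightarrow> cfun set" where
  "V P = {v\<in>H1 (Omega P). AE x in arc_measure. x \<in> Gamma_D P \<longrightarrow> boundary_trace (Omega P) v x = 0}"

definition V_h :: "helmholtz_problem \<Rightarrow> cfun set" where
  "V_h P = P1 (Omega P) (fine_mesh P) \<inter> V P"

definition L2_inner :: "point set \<Rightarrow> cfun \<Rightarrow> cfun \<Rightarrow> complex" where
  "L2_inner D v w = (LINT x:D|lebesgue. v x * cnj (w x))"

definition grad_inner :: "helmholtz_problem \<Rightarrow> point set \<Rightarrow> cfun \<Rightarrow> cfun \<Rightarrow> complex" where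
  "grad_inner P D v w =
     (LINT x:D|lebesgue. \<Sum>i\<in>UNIV. weak_grad (Omega P) v x $ i * cnj (weak_grad (Omega P) w x $ i))"

definition boundary_inner :: "helmholtz_problem \<Rightarrow> point set \<Rightarrow> cfun \<Rightarrow> cfun \<Rightarrow> complex" where
  "boundary_inner P \<Gamma> v w =
     (LINT x:\<Gamma>|arc_measure. boundary_trace (Omega P) v x * cnj (boundary_trace (Omega P) w x))"

definition b_on :: "helmholtz_problem \<Rightarrow> point set \<Rightarrow> cfun \<Rightarrow> cfun \<Rightarrow> complex" where
  "b_on P D v w = grad_inner P D v w + of_real ((wavenumber P)\<^sup>2) * L2_inner D v w"

definition energy_norm_on :: "helmholtz_problem \<Rightarrow> point set \<Rightarrow> cfun \<Rightarrow> real" where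
  "energy_norm_on P D v = sqrt (Re (b_on P D v v))"

definition a_on :: "helmholtz_problem \<Rightarrow> point set \<Rightarrow> cfun \<Rightarrow> cfun \<Rightarrow> complex" where
  "a_on P D v w =
     grad_inner P D v w - of_real ((wavenumber P)\<^sup>2) * L2_inner D v w
       - \<i> * of_real (wavenumber P) * boundary_inner P (Gamma_R P \<inter> closure D) v w"

abbreviation b_k :: "helmholtz_problem \<Rightarrow> cfun \<Rightarrow> cfun \<Rightarrow> complex" where
  "b_k P \<equiv> b_on P (Omega P)"

abbreviation a_k :: "helmholtz_problem \<Rightarrow> cfun \<Rightarrow> cfun \<Rightarrow> complex" where
  "a_k P \<equiv> a_on P (Omega P)"

abbreviation energy_norm :: "helmholtz_problem \<Rightarrow> cfun \<Rightarrow> real" where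
  "energy_norm P \<equiv> energy_norm_on P (Omega P)"

definition continuity_constant_on :: "helmholtz_problem \<Rightarrow> point set \<Rightarrow> real \<Rightarrow> bool" where
  "continuity_constant_on P D C \<longleftrightarrow>
     (\<forall>v\<in>V P. \<forall>w\<in>V P. cmod (a_on P D v w) \<le> C * energy_norm_on P D v * energy_norm_on P D w)"

definition antidual :: "helmholtz_problem \<Rightarrow> cfun set \<Rightarrow> (cfun \<Rightarrow> complex) set" where
  "antidual P X = {G.
     (\<forall>v\<in>X. \<forall>w\<in>X. G (\<lambda>x. v x + w x) = G v + G w) \<and>
     (\<forall>c. \<forall>v\<in>X. G (\<lambda>x. c * v x) = cnj c * G v) \<and>
     (\<exists>C. \<forall>v\<in>X. cmod (G v) \<le> C * energy_norm P v)}"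

definition nonzero :: "helmholtz_problem \<Rightarrow> cfun \<Rightarrow> bool" where
  "nonzero P w \<longleftrightarrow> \<not> (AE x in lebesgue. x \<in> Omega P \<longrightarrow> w x = 0)"

text \<open>With values in \<^typ>\<open>ennreal\<close>, the supremum over the trivial space is 0 and the infimum is \<open>\<infinity>\<close>.\<close>

definition dual_norm :: "helmholtz_problem \<Rightarrow> cfun set \<Rightarrow> (cfun \<Rightarrow> complex) \<Rightarrow> ennreal" where
  "dual_norm P X G = (SUP w\<in>{w\<in>X. nonzero P w}. ennreal (cmod (G w) / energy_norm P w))"

definition inf_sup_constant :: "helmholtz_problem \<Rightarrow> ennreal" where
  "inf_sup_constant P =
     (INF v\<in>{v\<in>V_h P. nonzero P v}. SUP w\<in>{w\<in>V_h P. nonzero P w}.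
        ennreal (cmod (a_k P v w) / (energy_norm P v * energy_norm P w)))"

section \<open>Quasi-interpolation and its kernel\<close>

text \<open>
  A discontinuous piecewise affine function is given by the affine function \<open>q T\<close> on each element \<open>T\<close>,
  so that \<open>q T z\<close> is the value at the vertex \<open>z\<close> taken from \<open>T\<close>.
\<close>

definition E_H :: "helmholtz_problem \<Rightarrow> (point set \<Rightarrow> cfun) \<Rightarrow> cfun" where
  "E_H P q = nodal_interpolant (Omega P) (coarse_mesh P)
     (\<lambda>z. if z \<in> closure (Gamma_D P) then 0
          else (\<Sum>T | T \<in> coarse_mesh P \<and> z \<in> closure T. q T z * of_real (measure lebesgue T)) /
               of_real (\<Sum>T | T \<in> coarse_mesh P \<and> z \<in> closure T. measure lebesgue T))"

definition I_H :: "helmholtz_problem \<Rightarrow> cfun \<Rightarrow> cfun" where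
  "I_H P v = E_H P (\<lambda>T. L2_proj T v)"

definition approximation_constant :: "helmholtz_problem \<Rightarrow> real \<Rightarrow> bool" where
  "approximation_constant P C \<longleftrightarrow>
     (\<forall>v\<in>V P. \<forall>T\<in>coarse_mesh P.
        sqrt (Re (L2_inner T (\<lambda>x. v x - I_H P v x) (\<lambda>x. v x - I_H P v x))) / diameter T
          \<le> C * sqrt (Re (grad_inner P (patch (coarse_mesh P) 1 T) v v)))"

text \<open>The mesh size function equals \<open>diameter T\<close> on \<open>T\<close>, so its sup norm is the maximal diameter.\<close>

definition chi_res :: "helmholtz_problem \<Rightarrow> real \<Rightarrow> real" where
  "chi_res P C_app =
     C_app * sqrt (real (C_patch (coarse_mesh P) 1)) * (wavenumber P * Max (diameter ` coarse_mesh P))"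

definition W_h :: "helmholtz_problem \<Rightarrow> cfun set" where
  "W_h P = {w\<in>V_h P. I_H P w = (\<lambda>_. 0)}"

definition W_loc :: "helmholtz_problem \<Rightarrow> point \<Rightarrow> cfun set" where
  "W_loc P z = {w\<in>W_h P. closure {x. w x \<noteq> 0} \<subseteq> closure (patch (coarse_mesh P) 2 {z})}"

definition stable_decomposition_constant :: "helmholtz_problem \<Rightarrow> real \<Rightarrow> bool" where
  "stable_decomposition_constant P C \<longleftrightarrow>
     (\<forall>w\<in>W_h P. \<exists>w'. (\<forall>z\<in>nodes (coarse_mesh P). w' z \<in> W_loc P z) \<and>
        w = (\<lambda>x. \<Sum>z\<in>nodes (coarse_mesh P). w' z x) \<and>
        (\<Sum>z\<in>nodes (coarse_mesh P). (energy_norm P (w' z))\<^sup>2) \<le> C\<^sup>2 * (energy_norm P w)\<^sup>2)"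

definition synthesis_constant :: "helmholtz_problem \<Rightarrow> real \<Rightarrow> bool" where
  "synthesis_constant P C \<longleftrightarrow>
     (\<forall>w'. (\<forall>z\<in>nodes (coarse_mesh P). w' z \<in> W_loc P z) \<longrightarrow>
        (energy_norm P (\<lambda>x. \<Sum>z\<in>nodes (coarse_mesh P). w' z x))\<^sup>2
          \<le> C\<^sup>2 * (\<Sum>z\<in>nodes (coarse_mesh P). (energy_norm P (w' z))\<^sup>2))"

section \<open>Residual indicators\<close>

definition xi :: "helmholtz_problem \<Rightarrow> (cfun \<Rightarrow> complex) \<Rightarrow> point \<Rightarrow> cfun" where
  "xi P G z = (THE \<xi>. \<xi> \<in> W_loc P z \<and> (\<forall>w\<in>W_loc P z. b_k P \<xi> w = G w))"

definition eta :: "helmholtz_problem \<Rightarrow> (cfun \<Rightarrow> complex) \<Rightarrow> real" where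
  "eta P G = sqrt (\<Sum>z\<in>nodes (coarse_mesh P). (energy_norm P (xi P G z))\<^sup>2)"

definition residual :: "helmholtz_problem \<Rightarrow> (cfun \<Rightarrow> complex) \<Rightarrow> cfun \<Rightarrow> cfun \<Rightarrow> complex" where
  "residual P F U w = F w - a_k P U w"

definition eta_H_loc :: "helmholtz_problem \<Rightarrow> (cfun \<Rightarrow> complex) \<Rightarrow> point \<Rightarrow> cfun \<Rightarrow> real" where
  "eta_H_loc P F z U = energy_norm P (xi P (residual P F U) z)"

definition eta_H :: "helmholtz_problem \<Rightarrow> (cfun \<Rightarrow> complex) \<Rightarrow> cfun \<Rightarrow> real" where
  "eta_H P F U = eta P (residual P F U)"

definition galerkin_solution :: "helmholtz_problem \<Rightarrow> (cfun \<Rightarrow> complex) \<Rightarrow> cfun \<Rightarrow> bool" where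
  "galerkin_solution P F u \<longleftrightarrow> u \<in> V_h P \<and> (\<forall>v\<in>V_h P. a_k P u v = F v)"

end

theory Submission
  imports Defs
begin

text \<open>
  The energy form \<open>b_k\<close> is an inner product on the finite element space, and the local function
  \<open>xi P G z\<close> is the Riesz representer of \<open>G\<close> in \<open>W_loc P z\<close>. Therefore \<open>G\<close> takes at each representer the
  value of its squared energy norm, and at the sum of all representers the value \<open>(eta P G)\<^sup>2\<close>. Since
  the synthesis constant bounds the norm of that sum by \<open>C_syn * eta P G\<close>, the dual norm of \<open>G\<close> is at
  least \<open>eta P G / C_syn\<close> (\<open>indicator_lower_bound\<close>). Conversely, a stable decomposition of \<open>w\<close> turns \<open>G w\<close>
  into a sum of energy products with the representers, and the Cauchy--Schwarz inequality gives the upper bound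
  (\<open>indicator_upper_bound\<close>).

  On \<open>V_h P\<close> the residual of \<open>U\<close> is \<open>a_k P (u - U)\<close>. The global estimate is the lower bound combined with
  continuity of the form. For the local estimate the residual is tested with \<open>xi\<close> itself; as \<open>xi\<close>
  is supported in the closed patch, the form reduces to its restriction to the patch
  (\<open>a_k_local\<close>).

  Because spaces, traces and projections are concrete objects, the linear structure behind this argument has to be
  established. Weak gradients are chosen arbitrarily from an almost everywhere
  class, so linearity and locality of the gradient term rest on the fundamental lemma of the calculus of
  variations, proved with explicit bump functions. The boundary term is
  linear for discrete functions because their traces are boundary values and a polygon has finite length. The
  kernel of the quasi-interpolation is a subspace because nodal interpolants on a conforming mesh exist and are unique
  and because the elementwise projection is linear. Riesz representers are obtained from the
  fact that a piecewise affine function is determined by finitely many nodal values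
  (\<open>finite_dimensional_Riesz\<close>).
\<close>

section \<open>Sesquilinear forms on spaces of functions\<close>

locale function_space =
  fixes S :: "('a \<Rightarrow> complex) set"
  assumes zero_mem: "(\<lambda>_. 0) \<in> S"
    and add_mem: "\<lbrakk>v \<in> S; w \<in> S\<rbrakk> \<Longrightarrow> (\<lambda>x. v x + w x) \<in> S"
    and scale_mem: "v \<in> S \<Longrightarrow> (\<lambda>x. c * v x) \<in> S"
begin

lemma diff_mem: "\<lbrakk>v \<in> S; w \<in> S\<rbrakk> \<Longrightarrow> (\<lambda>x. v x - w x) \<in> S"
  using add_mem[OF _ scale_mem[of w "-1"], of v] by simp

lemma sum_mem: "(\<And>z. z \<in> I \<Longrightarrow> f z \<in> S) \<Longrightarrow> (\<lambda>x. \<Sum>z\<in>I. f z x) \<in> S"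
  by (induction I rule: infinite_finite_induct) (simp_all add: zero_mem add_mem)

end

definition antilinear_on :: "('a \<Rightarrow> complex) set \<Rightarrow> (('a \<Rightarrow> complex) \<Rightarrow> complex) \<Rightarrow> bool" where
  "antilinear_on S G \<longleftrightarrow>
     (\<forall>v\<in>S. \<forall>w\<in>S. G (\<lambda>x. v x + w x) = G v + G w) \<and> (\<forall>c. \<forall>v\<in>S. G (\<lambda>x. c * v x) = cnj c * G v)"

lemma antilinear_on_subset: "antilinear_on S G \<Longrightarrow> T \<subseteq> S \<Longrightarrow> antilinear_on T G"
  unfolding antilinear_on_def by blast

lemma antilinear_onD:
  assumes "antilinear_on S G"
  shows "\<lbrakk>v \<in> S; w \<in> S\<rbrakk> \<Longrightarrow> G (\<lambda>x. v x + w x) = G v + G w"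
    and "v \<in> S \<Longrightarrow> G (\<lambda>x. c * v x) = cnj c * G v"
  using assms unfolding antilinear_on_def by blast+

lemma (in function_space) antilinear_on_sum:
  assumes G: "antilinear_on S G" and f: "\<And>z. z \<in> I \<Longrightarrow> f z \<in> S"
  shows "G (\<lambda>x. \<Sum>z\<in>I. f z x) = (\<Sum>z\<in>I. G (f z))"
  using f
proof (induction I rule: infinite_finite_induct)
  case (insert z I)
  then show ?case
    using antilinear_onD(1)[OF G, of "f z" "\<lambda>x. \<Sum>z\<in>I. f z x"] sum_mem[of I f] by simp
qed (use antilinear_onD(2)[OF G zero_mem, of 0] in simp_all)

text \<open>
  The form is only semidefinite because functions in \<open>H1\<close> that agree almost everywhere are not identified.
  Definiteness is a separate hypothesis, to be supplied by continuity of the functions.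
\<close>

locale hermitian_form = function_space S for S :: "('a \<Rightarrow> complex) set" +
  fixes b :: "('a \<Rightarrow> complex) \<Rightarrow> ('a \<Rightarrow> complex) \<Rightarrow> complex"
  assumes form_add: "\<lbrakk>u \<in> S; v \<in> S; w \<in> S\<rbrakk> \<Longrightarrow> b (\<lambda>x. u x + v x) w = b u w + b v w"
    and form_scale: "\<lbrakk>v \<in> S; w \<in> S\<rbrakk> \<Longrightarrow> b (\<lambda>x. c * v x) w = c * b v w"
    and form_cnj: "\<lbrakk>v \<in> S; w \<in> S\<rbrakk> \<Longrightarrow> b v w = cnj (b w v)"
    and form_nonneg: "v \<in> S \<Longrightarrow> 0 \<le> Re (b v v)"
begin

definition form_norm :: "('a \<Rightarrow> complex) \<Rightarrow> real" where
  "form_norm v = sqrt (Re (b v v))"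

lemma form_antilinear: "u \<in> S \<Longrightarrow> antilinear_on S (b u)"
  unfolding antilinear_on_def
proof (intro conjI ballI allI)
  fix v w assume "u \<in> S" "v \<in> S" "w \<in> S"
  then show "b u (\<lambda>x. v x + w x) = b u v + b u w"
    using form_cnj[of u v] form_cnj[of u w] form_cnj[of u "\<lambda>x. v x + w x"] form_add[of v w u] add_mem
    by simp
next
  fix c v assume "u \<in> S" "v \<in> S"
  then show "b u (\<lambda>x. c * v x) = cnj c * b u v"
    using form_cnj[of u v] form_cnj[of u "\<lambda>x. c * v x"] form_scale[of v u c] scale_mem by simp
qed

lemma form_diag: "v \<in> S \<Longrightarrow> b v v = of_real (Re (b v v))"
  using form_cnj[of v v] by (metis Reals_cnj_iff of_real_Re)

lemma form_norm_nonneg: "v \<in> S \<Longrightarrow> 0 \<le> form_norm v"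
  by (simp add: form_norm_def form_nonneg)

lemma form_norm_square: "v \<in> S \<Longrightarrow> b v v = of_real ((form_norm v)\<^sup>2)"
  using form_diag form_nonneg by (simp add: form_norm_def)

lemma form_norm_line:
  assumes "v \<in> S" "w \<in> S"
  shows "(form_norm (\<lambda>x. v x + c * w x))\<^sup>2
           = (form_norm v)\<^sup>2 + 2 * Re (cnj c * b v w) + (cmod c)\<^sup>2 * (form_norm w)\<^sup>2"
proof -
  let ?u = "\<lambda>x. c * w x"
  have u: "?u \<in> S" and vu: "(\<lambda>x. v x + ?u x) \<in> S" using assms scale_mem add_mem by simp_all
  have "b (\<lambda>x. v x + ?u x) (\<lambda>x. v x + ?u x) = b v v + b v ?u + (b ?u v + b ?u ?u)"
    using form_add[OF assms(1) u vu] antilinear_onD(1)[OF form_antilinear assms(1) u] assms(1) u by simp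
  moreover have "b v ?u = cnj c * b v w" "b ?u ?u = c * (cnj c * b w w)"
    using antilinear_onD(2)[OF form_antilinear] form_scale assms u by simp_all
  moreover have "b ?u v = cnj (b v ?u)" by (rule form_cnj[OF u assms(1)])
  moreover have "c * (cnj c * b w w) = of_real ((cmod c)\<^sup>2 * (form_norm w)\<^sup>2)"
    unfolding form_norm_square[OF assms(2)] of_real_mult complex_norm_square[of c]
    by (rule mult.assoc[symmetric])
  ultimately have "b (\<lambda>x. v x + ?u x) (\<lambda>x. v x + ?u x)
      = of_real ((form_norm v)\<^sup>2) + (cnj c * b v w + cnj (cnj c * b v w)) + of_real ((cmod c)\<^sup>2 * (form_norm w)\<^sup>2)"
    using form_norm_square[OF assms(1)] by (simp only: add.assoc)
  then have "b (\<lambda>x. v x + ?u x) (\<lambda>x. v x + ?u x)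
      = of_real ((form_norm v)\<^sup>2 + 2 * Re (cnj c * b v w) + (cmod c)\<^sup>2 * (form_norm w)\<^sup>2)"
    unfolding complex_add_cnj of_real_add .
  then show ?thesis unfolding form_norm_square[OF vu] of_real_eq_iff .
qed

text \<open>
  The quadratic polynomial of the squared norm along a line is nonnegative. If \<open>w\<close> has norm zero, the
  polynomial is affine in the parameter, which forces \<open>b v w = 0\<close>; this covers the semidefinite case.
\<close>

lemma Cauchy_Schwarz:
  assumes "v \<in> S" "w \<in> S"
  shows "cmod (b v w) \<le> form_norm v * form_norm w"
proof -
  let ?\<beta> = "b v w"
  have quad: "0 \<le> (form_norm v)\<^sup>2 - 2 * t * (cmod ?\<beta>)\<^sup>2 + t\<^sup>2 * (cmod ?\<beta>)\<^sup>2 * (form_norm w)\<^sup>2" for t :: real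
  proof -
    have "Re (cnj (- of_real t * ?\<beta>) * ?\<beta>) = - t * (cmod ?\<beta>)\<^sup>2"
      using complex_norm_square[of ?\<beta>] by (simp add: cmod_power2) (simp add: power2_eq_square algebra_simps)
    moreover have "(cmod (- of_real t * ?\<beta>))\<^sup>2 = t\<^sup>2 * (cmod ?\<beta>)\<^sup>2"
      by (simp add: norm_mult power_mult_distrib)
    ultimately show ?thesis
      using form_norm_line[OF assms, of "- of_real t * ?\<beta>"]
        zero_le_power2[of "form_norm (\<lambda>x. v x + - of_real t * ?\<beta> * w x)"] by simp
  qed
  show ?thesis
  proof (cases "form_norm w = 0")
    case True
    have "?\<beta> = 0"
    proof (rule ccontr)
      assume "?\<beta> \<noteq> 0"
      then have "2 * (((form_norm v)\<^sup>2 + 1) / (2 * (cmod ?\<beta>)\<^sup>2)) * (cmod ?\<beta>)\<^sup>2 = (form_norm v)\<^sup>2 + 1"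
        by (simp add: field_simps)
      then show False using quad[of "((form_norm v)\<^sup>2 + 1) / (2 * (cmod ?\<beta>)\<^sup>2)"] True by simp
    qed
    then show ?thesis using True by simp
  next
    case False
    then have pos: "0 < (form_norm w)\<^sup>2" by simp
    have "2 * (1 / (form_norm w)\<^sup>2) * (cmod ?\<beta>)\<^sup>2 = 2 * ((cmod ?\<beta>)\<^sup>2 / (form_norm w)\<^sup>2)"
      "(1 / (form_norm w)\<^sup>2)\<^sup>2 * (cmod ?\<beta>)\<^sup>2 * (form_norm w)\<^sup>2 = (cmod ?\<beta>)\<^sup>2 / (form_norm w)\<^sup>2"
      using False by (simp_all add: power2_eq_square)
    then have "(cmod ?\<beta>)\<^sup>2 / (form_norm w)\<^sup>2 \<le> (form_norm v)\<^sup>2"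
      using quad[of "1 / (form_norm w)\<^sup>2"] by linarith
    then have "(cmod ?\<beta>)\<^sup>2 \<le> (form_norm v)\<^sup>2 * (form_norm w)\<^sup>2"
      using pos by (simp add: pos_divide_le_eq)
    then show ?thesis
      using form_norm_nonneg assms
      by (intro power2_le_imp_le[of "cmod ?\<beta>"] mult_nonneg_nonneg) (simp_all add: power_mult_distrib)
  qed
qed

lemma hermitian_form_subspace: "function_space T \<Longrightarrow> T \<subseteq> S \<Longrightarrow> hermitian_form T b"
  by (intro hermitian_form.intro hermitian_form_axioms.intro)
    (auto intro: form_add form_scale form_cnj form_nonneg)

lemma form_representer_unique:
  assumes definite: "\<And>v. v \<in> S \<Longrightarrow> b v v = 0 \<Longrightarrow> v = (\<lambda>_. 0)"
    and uv: "u \<in> S" "v \<in> S" "\<And>w. w \<in> S \<Longrightarrow> b u w = b v w"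
  shows "u = v"
proof -
  have d: "(\<lambda>x. u x - v x) \<in> S" using uv diff_mem by simp
  have "b (\<lambda>x. u x - v x) w = b u w - b v w" if "w \<in> S" for w
    using form_add[OF \<open>u \<in> S\<close> scale_mem[OF \<open>v \<in> S\<close>] that, of "-1"] form_scale[OF \<open>v \<in> S\<close> that, of "-1"]
    by simp
  then have "b (\<lambda>x. u x - v x) (\<lambda>x. u x - v x) = 0" using d uv by simp
  then have "(\<lambda>x. u x - v x) = (\<lambda>_. 0)" using definite d by blast
  then show ?thesis by (metis eq_iff_diff_eq_0 ext)
qed

end

text \<open>
  The finite set of points at which the values determine an element takes the place of a basis.
  Induction on that set: the functions vanishing at \<open>z\<close> form a subspace
  determined by the remaining points, of codimension at most one. A function orthogonal to this subspace
  with value 1 at \<open>z\<close> is found by projecting with the induction hypothesis, and the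
  representer on the subspace is corrected by a multiple of it.
\<close>

theorem finite_dimensional_Riesz:
  assumes "finite N" and "hermitian_form S b"
    and determining: "\<And>v. v \<in> S \<Longrightarrow> \<forall>x\<in>N. v x = 0 \<Longrightarrow> v = (\<lambda>_. 0)"
    and definite: "\<And>v. v \<in> S \<Longrightarrow> b v v = 0 \<Longrightarrow> v = (\<lambda>_. 0)"
    and "antilinear_on S G"
  shows "\<exists>\<xi>\<in>S. \<forall>w\<in>S. b \<xi> w = G w"
  using assms
proof (induction N arbitrary: S G rule: finite_induct)
  case empty
  interpret hermitian_form S b by fact
  have "b (\<lambda>_. 0) (\<lambda>_. 0) = 0" using form_scale[OF zero_mem zero_mem, of 0] by simp
  moreover have "G (\<lambda>_. 0) = 0" using antilinear_onD(2)[OF empty.prems(4) zero_mem, of 0] by simp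
  moreover have "S = {\<lambda>_. 0}" using empty.prems(2) zero_mem by blast
  ultimately show ?case by simp
next
  case (insert z N)
  interpret hermitian_form S b by fact
  define T where "T = {v\<in>S. v z = 0}"
  have TS: "T \<subseteq> S" by (auto simp: T_def)
  have fsT: "function_space T"
    by unfold_locales (simp_all add: T_def zero_mem add_mem scale_mem)
  have hT: "hermitian_form T b" by (rule hermitian_form_subspace[OF fsT TS])
  have IH: "\<exists>\<xi>\<in>T. \<forall>w\<in>T. b \<xi> w = J w" if "antilinear_on T J" for J
    by (rule insert.IH[OF hT _ _ that]) (use insert.prems(2,3) in \<open>unfold T_def, blast+\<close>)
  obtain \<xi> where \<xi>: "\<xi> \<in> T" "\<And>w. w \<in> T \<Longrightarrow> b \<xi> w = G w"
    using IH[OF antilinear_on_subset[OF insert.prems(4) TS]] by blast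
  show ?case
  proof (cases "S = T")
    case True
    then show ?thesis using \<xi> by blast
  next
    case False
    then obtain d where d: "d \<in> S" "d z \<noteq> 0" by (auto simp: T_def)
    define e0 where "e0 = (\<lambda>x. inverse (d z) * d x)"
    have e0: "e0 \<in> S" "e0 z = 1" using d scale_mem by (simp_all add: e0_def)
    \<comment> \<open>Subtracting its orthogonal projection to \<open>T\<close> makes \<open>e0\<close> orthogonal to \<open>T\<close>.\<close>
    obtain p where p: "p \<in> T" "\<And>w. w \<in> T \<Longrightarrow> b p w = b e0 w"
      using IH[OF antilinear_on_subset[OF form_antilinear[OF e0(1)] TS]] by blast
    define e where "e = (\<lambda>x. e0 x - p x)"
    have eS: "e \<in> S" using diff_mem e0(1) p(1) TS unfolding e_def by blast
    have ez: "e z = 1" using e0(2) p(1) by (simp add: e_def T_def)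
    have orth: "b e w = 0" if "w \<in> T" for w
    proof -
      have w: "w \<in> S" "p \<in> S" using that p(1) TS by auto
      show ?thesis
        using form_add[OF e0(1) scale_mem[OF w(2)] w(1), of "-1"] form_scale[OF w(2) w(1), of "-1"] p(2)[OF that]
        by (simp add: e_def)
    qed
    have ee: "b e e \<noteq> 0" using insert.prems(3)[OF eS] ez by force
    define c where "c = G e / b e e"
    have \<xi>S: "\<xi> \<in> S" using \<xi>(1) TS by auto
    show ?thesis
    proof (intro bexI ballI)
      show m: "(\<lambda>x. \<xi> x + c * e x) \<in> S" using add_mem[OF \<xi>S scale_mem[OF eS]] by simp
      fix w assume w: "w \<in> S"
      define w' where "w' = (\<lambda>x. w x - w z * e x)"
      have w'T: "w' \<in> T" using diff_mem[OF w scale_mem[OF eS]] ez by (simp add: T_def w'_def)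
      then have w'S: "w' \<in> S" using TS by auto
      have split: "w = (\<lambda>x. w z * e x + w' x)" by (simp add: w'_def)
      have Gw: "J w = cnj (w z) * J e + J w'" if J: "antilinear_on S J" for J
      proof -
        have "J w = J (\<lambda>x. w z * e x + w' x)" by (rule arg_cong[OF split])
        also have "\<dots> = J (\<lambda>x. w z * e x) + J w'" by (rule antilinear_onD(1)[OF J scale_mem[OF eS] w'S])
        also have "J (\<lambda>x. w z * e x) = cnj (w z) * J e" by (rule antilinear_onD(2)[OF J eS])
        finally show ?thesis .
      qed
      have bv: "b (\<lambda>x. \<xi> x + c * e x) v = b \<xi> v + c * b e v" if "v \<in> S" for v
        using form_add[OF \<xi>S scale_mem[OF eS] that] form_scale[OF eS that] by simp
      have "b \<xi> e = 0" using form_cnj[OF \<xi>S eS] orth[OF \<xi>(1)] by simp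
      then have "b (\<lambda>x. \<xi> x + c * e x) e = G e" using bv[OF eS] ee by (simp add: c_def)
      moreover have "b (\<lambda>x. \<xi> x + c * e x) w' = G w'" using bv[OF w'S] orth[OF w'T] \<xi>(2)[OF w'T] by simp
      ultimately show "b (\<lambda>x. \<xi> x + c * e x) w = G w"
        unfolding Gw[OF form_antilinear[OF m]] Gw[OF insert.prems(4)] by (rule arg_cong2[where f="\<lambda>s t. cnj (w z) * s + t"])
    qed
  qed
qed

section \<open>Test functions and the fundamental lemma of the calculus of variations\<close>

text \<open>
  The division by \<open>t ^ m\<close> makes the family closed under differentiation up to linear combinations,
  so a single formula serves all orders of derivatives.
\<close>

definition flat :: "nat \<Rightarrow> real \<Rightarrow> real" where
  "flat m t = (if 0 < t then exp (- 1 / t) / t ^ m else 0)"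

text \<open>
  In the variable \<open>1 / t\<close> this is the decay of a power times a decreasing exponential.
\<close>

lemma flat_tendsto_0: "(flat m \<longlongrightarrow> 0) (at_right 0)"
proof -
  have "((\<lambda>t::real. inverse t ^ m / exp (inverse t)) \<longlongrightarrow> 0) (at_right 0)"
    by (rule filterlim_compose[OF tendsto_power_div_exp_0 filterlim_inverse_at_top_right])
  moreover have "\<forall>\<^sub>F t in at_right 0. inverse t ^ m / exp (inverse t) = flat m t"
    unfolding eventually_at_right_field
    by (intro exI[of _ 1]) (auto simp: flat_def exp_minus field_simps)
  ultimately show ?thesis by (rule Lim_transform_eventually)
qed

lemma flat_DERIV: "(flat m has_real_derivative flat (m + 2) t - real m * flat (m + 1) t) (at t)"
proof -
  consider "t > 0" | "t < 0" | "t = 0" by linarith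
  then show ?thesis
  proof cases
    case 1
    have "((\<lambda>t. exp (- 1 / t) / t ^ m) has_real_derivative flat (m + 2) t - real m * flat (m + 1) t) (at t)"
      using 1
      by (cases m; auto intro!: derivative_eq_intros simp: flat_def; simp add: field_simps power2_eq_square;
          metis One_nat_def Suc_pred neq0_conv power_Suc)
    then show ?thesis
      by (rule has_field_derivative_transform_within_open[of _ _ _ "{0<..}"]) (use 1 in \<open>auto simp: flat_def\<close>)
  next
    case 2
    have "((\<lambda>t. 0) has_real_derivative flat (m + 2) t - real m * flat (m + 1) t) (at t)"
      using 2 by (simp add: flat_def)
    then show ?thesis
      by (rule has_field_derivative_transform_within_open[of _ _ _ "{..<0}"]) (use 2 in \<open>auto simp: flat_def\<close>)
  next
    case 3
    have "((\<lambda>h. flat m h / h) \<longlongrightarrow> 0) (at_left 0)"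
      by (rule Lim_transform_eventually[of "\<lambda>_. 0"])
        (auto simp: flat_def eventually_at_left_field intro!: exI[of _ "-1"])
    moreover have "((\<lambda>h. flat m h / h) \<longlongrightarrow> 0) (at_right 0)"
      by (rule Lim_transform_eventually[OF flat_tendsto_0[of "m + 1"]])
        (auto simp: flat_def eventually_at_right_field intro!: exI[of _ 1])
    ultimately have "((\<lambda>h. flat m h / h) \<longlongrightarrow> 0) (at 0)" by (rule filterlim_split_at)
    then show ?thesis using 3 by (simp add: DERIV_def flat_def)
  qed
qed

lemma flat_range: "0 \<le> flat 0 t" "flat 0 t \<le> 1"
  by (simp_all add: flat_def)

text \<open>
  An algebra that is closed under partial derivatives. Membership is proved by structural induction, so
  smoothness of all orders follows without handling a Leibniz rule of higher order.
\<close>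

inductive_set flat_algebra :: "(point \<Rightarrow> real) set" where
  flat: "(\<lambda>x. flat m (\<alpha> * x $ i + \<beta>)) \<in> flat_algebra"
| const: "(\<lambda>_. c) \<in> flat_algebra"
| add: "\<lbrakk>f \<in> flat_algebra; g \<in> flat_algebra\<rbrakk> \<Longrightarrow> (\<lambda>x. f x + g x) \<in> flat_algebra"
| mult: "\<lbrakk>f \<in> flat_algebra; g \<in> flat_algebra\<rbrakk> \<Longrightarrow> (\<lambda>x. f x * g x) \<in> flat_algebra"

lemma partial_deriv_eqI: "(\<And>x. (f has_derivative f' x) (at x)) \<Longrightarrow> partial_deriv j f = (\<lambda>x. f' x (axis j 1))"
  unfolding partial_deriv_def fun_eq_iff by (metis frechet_derivative_at)

lemma flat_algebra_smooth:
  "f \<in> flat_algebra \<Longrightarrow> (\<forall>x. f differentiable at x) \<and> partial_deriv j f \<in> flat_algebra"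
proof (induction rule: flat_algebra.induct)
  case (flat m \<alpha> i \<beta>)
  define D where "D x = flat (m + 2) (\<alpha> * x $ i + \<beta>) - real m * flat (m + 1) (\<alpha> * x $ i + \<beta>)" for x :: point
  have der: "((\<lambda>x. flat m (\<alpha> * x $ i + \<beta>)) has_derivative (\<lambda>v. D x * (\<alpha> * v $ i))) (at x)" for x :: point
  proof -
    have "((\<lambda>x::point. \<alpha> * x $ i + \<beta>) has_derivative (\<lambda>v. \<alpha> * v $ i)) (at x)"
      by (auto intro!: derivative_eq_intros bounded_linear_imp_has_derivative bounded_linear_vec_nth)
    then show ?thesis
      using flat_DERIV[THEN DERIV_compose_FDERIV, where g = "\<lambda>x::point. \<alpha> * x $ i + \<beta>" and x = x] 
      by (simp add: D_def mult.commute)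
  qed
  have "partial_deriv j (\<lambda>x. flat m (\<alpha> * x $ i + \<beta>)) = (\<lambda>x. D x * (\<alpha> * (axis j 1 :: point) $ i))"
    by (rule partial_deriv_eqI) (rule der)
  also have "\<dots> = (\<lambda>x. (flat (m + 2) (\<alpha> * x $ i + \<beta>) + (- real m) * flat (m + 1) (\<alpha> * x $ i + \<beta>))
                        * (\<alpha> * (axis j 1 :: point) $ i))"
    by (simp add: D_def)
  also have "\<dots> \<in> flat_algebra" by (intro flat_algebra.intros)
  finally show ?case using der unfolding differentiable_def by blast
next
  case (const c)
  have "partial_deriv j (\<lambda>_. c) = (\<lambda>_. 0)" by (rule partial_deriv_eqI) (rule has_derivative_const)
  then show ?case by (simp add: flat_algebra.const)
next
  case (add f g)
  then have d: "(f has_derivative frechet_derivative f (at x)) (at x)"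
    "(g has_derivative frechet_derivative g (at x)) (at x)" for x
    by (simp_all add: frechet_derivative_works)
  have "partial_deriv j (\<lambda>x. f x + g x) = (\<lambda>x. partial_deriv j f x + partial_deriv j g x)"
    by (rule trans[OF partial_deriv_eqI[OF has_derivative_add[OF d]]]) (simp add: partial_deriv_def)
  then show ?case using add by (auto intro: flat_algebra.add)
next
  case (mult f g)
  then have d: "(f has_derivative frechet_derivative f (at x)) (at x)"
    "(g has_derivative frechet_derivative g (at x)) (at x)" for x
    by (simp_all add: frechet_derivative_works)
  have "partial_deriv j (\<lambda>x. f x * g x) = (\<lambda>x. f x * partial_deriv j g x + partial_deriv j f x * g x)"
    by (rule trans[OF partial_deriv_eqI[OF has_derivative_mult[OF d]]]) (simp add: partial_deriv_def)
  then show ?case using mult by (auto intro: flat_algebra.add flat_algebra.mult)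
qed

lemma flat_algebra_iterated:
  assumes "f \<in> flat_algebra"
  shows "foldr partial_deriv is f differentiable_on UNIV"
proof -
  have "foldr partial_deriv is f \<in> flat_algebra"
    by (induction "is") (use assms flat_algebra_smooth in auto)
  then show ?thesis using flat_algebra_smooth by (simp add: differentiable_on_def)
qed

text \<open>
  A product of one-dimensional factors, one for each side of the box. Scaling the argument by \<open>Suc n\<close>
  takes the \<open>Suc n\<close>-th root of each factor, so that it tends to 1 wherever it is positive.
\<close>

definition bump :: "point \<Rightarrow> point \<Rightarrow> nat \<Rightarrow> point \<Rightarrow> real" where
  "bump a b n x =
     flat 0 (real (Suc n) * (x $ 1 - a $ 1)) * flat 0 (real (Suc n) * (b $ 1 - x $ 1)) *
     (flat 0 (real (Suc n) * (x $ 2 - a $ 2)) * flat 0 (real (Suc n) * (b $ 2 - x $ 2)))"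

lemma mem_box_2: "x \<in> box a b \<longleftrightarrow> a $ 1 < x $ 1 \<and> x $ 1 < b $ 1 \<and> a $ 2 < x $ 2 \<and> x $ 2 < b $ 2" for x :: point
  by (auto simp: mem_box_cart forall_2)

lemma bump_nonzero_iff: "bump a b n x \<noteq> 0 \<longleftrightarrow> x \<in> box a b"
  by (auto simp: bump_def mem_box_2 flat_def zero_less_mult_iff)

lemma bump_range: "0 \<le> bump a b n x" "bump a b n x \<le> 1"
  unfolding bump_def by (intro mult_nonneg_nonneg mult_le_one flat_range)+

lemma test_function_bump:
  assumes "cbox a b \<subseteq> \<Omega>"
  shows "test_function \<Omega> (bump a b n)"
  unfolding test_function_def
proof (intro conjI allI)
  have "bump a b n = (\<lambda>x.
     flat 0 (real (Suc n) * x $ 1 + - real (Suc n) * a $ 1) * flat 0 (- real (Suc n) * x $ 1 + real (Suc n) * b $ 1) *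
     (flat 0 (real (Suc n) * x $ 2 + - real (Suc n) * a $ 2) * flat 0 (- real (Suc n) * x $ 2 + real (Suc n) * b $ 2)))"
    unfolding bump_def by (intro ext arg_cong2[of _ _ _ _ "(*)"] arg_cong[of _ _ "flat 0"]) (simp_all add: algebra_simps)
  also have "\<dots> \<in> flat_algebra" by (intro flat_algebra.intros)
  finally show "foldr partial_deriv is (bump a b n) differentiable_on UNIV" for "is"
    by (rule flat_algebra_iterated)
  have "closure {x. bump a b n x \<noteq> 0} \<subseteq> cbox a b"
    by (rule closure_minimal) (auto simp: bump_nonzero_iff box_subset_cbox[THEN subsetD])
  then show "closure {x. bump a b n x \<noteq> 0} \<subseteq> \<Omega>" "compact (closure {x. bump a b n x \<noteq> 0})"
    using assms bounded_subset[OF bounded_cbox] by (auto simp: compact_eq_bounded_closed)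
qed

lemma bump_tendsto: "(\<lambda>n. bump a b n x) \<longlonglongrightarrow> indicator (box a b) x"
proof (cases "x \<in> box a b")
  case True
  have "(\<lambda>n. flat 0 (real (Suc n) * s)) \<longlonglongrightarrow> 1" if "0 < s" for s
  proof -
    have "(\<lambda>n. exp (- (inverse (real (Suc n)) * (1 / s)))) \<longlonglongrightarrow> exp (- (0 * (1 / s)))"
      by (intro tendsto_intros LIMSEQ_inverse_real_of_nat)
    moreover have "exp (- (inverse (real (Suc n)) * (1 / s))) = flat 0 (real (Suc n) * s)" for n
      using that by (auto simp: flat_def inverse_eq_divide simp del: of_nat_Suc)
    ultimately show ?thesis by simp
  qed
  then have "(\<lambda>n. bump a b n x) \<longlonglongrightarrow> 1 * 1 * (1 * 1)"
    unfolding bump_def by (intro tendsto_mult) (use True in \<open>auto simp: mem_box_2\<close>)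
  then show ?thesis using True by simp
next
  case False
  then have "bump a b n x = 0" for n using bump_nonzero_iff by blast
  then show ?thesis using False by simp
qed

lemma continuous_imp_lebesgue_measurable:
  "continuous_on UNIV f \<Longrightarrow> f \<in> borel_measurable lebesgue" for f :: "'a::euclidean_space \<Rightarrow> 'b::euclidean_space"
  by (rule measurable_completion) (simp add: borel_measurable_continuous_onI)

text \<open>
  The bump functions tend boundedly to the indicator of the box, so dominated convergence applies.
\<close>

lemma integral_box_zero:
  fixes f :: "point \<Rightarrow> complex"
  assumes f: "set_integrable lebesgue \<Omega> f"
    and zero: "\<And>\<phi>. test_function \<Omega> \<phi> \<Longrightarrow> (LINT x:\<Omega>|lebesgue. \<phi> x *\<^sub>R f x) = 0"
    and sub: "cbox a b \<subseteq> \<Omega>"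
  shows "(LINT x:box a b|lebesgue. f x) = 0"
proof -
  have meas: "(\<lambda>x. bump a b n x) \<in> borel_measurable lebesgue" for n
    using test_function_bump[OF sub, of n, unfolded test_function_def, THEN conjunct1, rule_format, of "[]"]
    by (intro continuous_imp_lebesgue_measurable differentiable_imp_continuous_on) simp
  have int: "integrable lebesgue (\<lambda>x. indicator \<Omega> x *\<^sub>R f x)"
    using f by (simp add: set_integrable_def)
  have "(\<lambda>n. LINT x|lebesgue. bump a b n x *\<^sub>R (indicator \<Omega> x *\<^sub>R f x))
          \<longlonglongrightarrow> (LINT x|lebesgue. indicator (box a b) x *\<^sub>R (indicator \<Omega> x *\<^sub>R f x))"
  proof (rule integral_dominated_convergence[where w="\<lambda>x. norm (indicator \<Omega> x *\<^sub>R f x)"])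
    show "integrable lebesgue (\<lambda>x. norm (indicator \<Omega> x *\<^sub>R f x))" using int by (rule integrable_norm)
    show "AE x in lebesgue. (\<lambda>n. bump a b n x *\<^sub>R indicator \<Omega> x *\<^sub>R f x)
            \<longlonglongrightarrow> indicator (box a b) x *\<^sub>R indicator \<Omega> x *\<^sub>R f x"
      by (intro AE_I2 tendsto_scaleR bump_tendsto tendsto_const)
    show "AE x in lebesgue. norm (bump a b n x *\<^sub>R indicator \<Omega> x *\<^sub>R f x) \<le> norm (indicator \<Omega> x *\<^sub>R f x)" for n
      using bump_range by (intro AE_I2) (simp add: mult.assoc mult_left_le_one_le)
    show "(\<lambda>x. bump a b n x *\<^sub>R indicator \<Omega> x *\<^sub>R f x) \<in> borel_measurable lebesgue" for n
      using meas int by measurable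
    show "(\<lambda>x. indicator (box a b) x *\<^sub>R indicator \<Omega> x *\<^sub>R f x) \<in> borel_measurable lebesgue"
      by (rule borel_measurable_scaleR[OF borel_measurable_indicator borel_measurable_integrable[OF int]]) simp
  qed
  moreover have "(LINT x|lebesgue. bump a b n x *\<^sub>R (indicator \<Omega> x *\<^sub>R f x)) = 0" for n
    using zero[OF test_function_bump[OF sub, of n]]
    by (simp add: set_lebesgue_integral_def scaleR_left_commute mult.commute)
  moreover have "indicator (box a b) x *\<^sub>R (indicator \<Omega> x *\<^sub>R f x) = indicat_real (box a b) x *\<^sub>R f x" for x
    using sub box_subset_cbox[of a b] by (auto simp: indicator_def)
  ultimately show ?thesis by (simp only: set_lebesgue_integral_def LIMSEQ_const_iff)
qed

text \<open>
  Boxes are stable under intersection and generate the Borel sets, so the vanishing of the integrals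
  extends to all Borel sets by the Dynkin argument, and to Lebesgue sets since they differ from Borel sets by null
  sets. A function with vanishing integral over every measurable set is zero almost everywhere.
\<close>

lemma AE_zero_box:
  fixes f :: "point \<Rightarrow> complex"
  assumes f: "set_integrable lebesgue (box c d) f"
    and zero: "\<And>a b. box a b \<subseteq> box c d \<Longrightarrow> (LINT x:box a b|lebesgue. f x) = 0"
  shows "AE x in lebesgue. x \<in> box c d \<longrightarrow> f x = 0"
proof -
  define h where "h = (\<lambda>x. indicat_real (box c d) x *\<^sub>R f x)"
  have h: "integrable lebesgue h" using f by (simp add: set_integrable_def h_def)
  have si: "set_integrable lebesgue A h" if "A \<in> sets lebesgue" for A
    using h that by (simp add: set_integrable_def integrable_mult_indicator)
  have UN: "(LINT x:UNIV|lebesgue. h x) = 0"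
    using zero[of c d] by (simp add: set_lebesgue_integral_def h_def)
  have borel: "(LINT x:A|lebesgue. h x) = 0" if "A \<in> sets borel" for A
  proof -
    have "Int_stable (range (\<lambda>(a, b). box a b) :: point set set)"
      by (auto simp: Int_stable_def box_Int_box)
    moreover have "range (\<lambda>(a, b). box a b) \<subseteq> Pow (UNIV :: point set)" by simp
    moreover have "A \<in> sigma_sets UNIV (range (\<lambda>(a, b). box a b))"
      using that unfolding borel_eq_box by simp
    ultimately show ?thesis
    proof (induction rule: sigma_sets_induct_disjoint)
      case (basic A)
      then obtain a b where A: "A = box a b" by auto
      obtain a' b' where I: "box a b \<inter> box c d = box a' b'" by (simp add: Int_interval box_Int_box)
      have "(LINT x:A|lebesgue. h x) = (LINT x:box a' b'|lebesgue. f x)"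
        by (simp add: set_lebesgue_integral_def h_def A indicator_inter_arith flip: I)
      then show ?case using zero[of a' b'] I by auto
    next
      case (compl A)
      then have A: "A \<in> sets lebesgue" by (simp add: borel_eq_box)
      have "(LINT x:UNIV|lebesgue. h x) = (LINT x:(UNIV - A) \<union> A|lebesgue. h x)" by simp
      also have "\<dots> = (LINT x:UNIV - A|lebesgue. h x) + (LINT x:A|lebesgue. h x)"
        using A by (intro set_integral_Un si) auto
      finally show ?case using compl UN by simp
    next
      case (union A)
      then have "A i \<in> sets borel" for i unfolding borel_eq_box by auto
      then have A: "A i \<in> sets lebesgue" for i by auto
      have "(LINT x:(\<Union>i. A i)|lebesgue. h x) = (\<Sum>i. (LINT x:(A i)|lebesgue. h x))"
        using A union(1) by (intro lebesgue_integral_countable_add si) (auto simp: disjoint_family_on_def)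
      then show ?case using union(3) by simp
    qed (simp_all add: set_lebesgue_integral_def)
  qed
  have "AE x in lebesgue. h x = 0"
  proof (rule sigma_finite_measure.density_zero[OF _ h])
    obtain \<A> :: "point set set" where \<A>: "countable \<A>" "\<A> \<subseteq> sets lborel" "\<Union>\<A> = space lborel" "\<And>A. A \<in> \<A> \<Longrightarrow> emeasure lborel A \<noteq> \<infinity>"
      using lborel.sigma_finite_countable by metis
    show "sigma_finite_measure (lebesgue :: point measure)"
      by (standard, rule exI[of _ \<A>]) (use \<A> in \<open>auto simp: emeasure_completion\<close>)
    fix A :: "point set" assume A: "A \<in> sets lebesgue"
    obtain B N N' where B: "A = B \<union> N" "N \<subseteq> N'" "N' \<in> null_sets lborel" "B \<in> sets lborel"
      using sets_completionE[OF A] by metis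
    have "AE x in lebesgue. x \<notin> N'" using B(3) by (intro AE_not_in null_sets_completionI)
    then have ae: "AE x in lebesgue. x \<in> B \<longleftrightarrow> x \<in> A"
      by eventually_elim (use B in auto)
    have "(LINT x:A|lebesgue. h x) = (LINT x:B|lebesgue. h x)"
      using ae si[unfolded set_integrable_def, THEN borel_measurable_integrable] A B(4)
      by (intro set_integral_cong_set) (auto simp: set_borel_measurable_def)
    then show "(LINT x:A|lebesgue. h x) = 0" using borel B(4) by simp
  qed
  then show ?thesis by (rule AE_mp) (auto simp: h_def)
qed

text \<open>
  An open set is a countable union of closed boxes, and a closed box differs from its interior by a null set.
\<close>

theorem fundamental_lemma:
  fixes f :: "point \<Rightarrow> complex"
  assumes "open \<Omega>" and f: "set_integrable lebesgue \<Omega> f"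
    and zero: "\<And>\<phi>. test_function \<Omega> \<phi> \<Longrightarrow> (LINT x:\<Omega>|lebesgue. \<phi> x *\<^sub>R f x) = 0"
  shows "AE x in lebesgue. x \<in> \<Omega> \<longrightarrow> f x = 0"
proof -
  obtain \<D> where \<D>: "countable \<D>" "\<D> \<subseteq> Pow \<Omega>" "\<And>X. X \<in> \<D> \<Longrightarrow> \<exists>a b. X = cbox a b" "\<Union>\<D> = \<Omega>"
    using open_countable_Union_open_cbox[OF \<open>open \<Omega>\<close>] by metis
  have "AE x in lebesgue. \<forall>X\<in>\<D>. x \<in> X \<longrightarrow> f x = 0"
    unfolding AE_ball_countable[OF \<D>(1)]
  proof
    fix X assume "X \<in> \<D>"
    then obtain a b where X: "X = cbox a b" "cbox a b \<subseteq> \<Omega>" using \<D> by blast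
    have "AE x in lebesgue. x \<in> box a b \<longrightarrow> f x = 0"
    proof (rule AE_zero_box)
      show "set_integrable lebesgue (box a b) f"
        using X box_subset_cbox[of a b] by (intro set_integrable_subset[OF f]) auto
      fix u v assume uv: "box u v \<subseteq> box a b"
      show "(LINT x:box u v|lebesgue. f x) = 0"
      proof (cases "box u v = {}")
        case False
        then have "cbox u v \<subseteq> cbox a b" using uv by (metis closure_box closure_mono False box_subset_cbox bot.extremum_uniqueI closure_empty)
        then show ?thesis using integral_box_zero[OF f zero] X by blast
      qed (simp add: set_lebesgue_integral_def)
    qed
    moreover have "AE x in lebesgue. x \<notin> cbox a b - box a b"
      using negligible_frontier_interval[of a b] unfolding negligible_iff_null_sets by (rule AE_not_in)
    ultimately show "AE x in lebesgue. x \<in> X \<longrightarrow> f x = 0" by eventually_elim (auto simp: X)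
  qed
  then show ?thesis by (rule AE_mp) (use \<D>(4) in auto)
qed

section \<open>Square integrable functions\<close>

lemma set_LINT_cong_AE:
  fixes f g :: "'a \<Rightarrow> 'b::{banach, second_countable_topology}"
  assumes "set_borel_measurable M D f" "set_borel_measurable M D g" "AE x in M. x \<in> D \<longrightarrow> f x = g x"
  shows "(LINT x:D|M. f x) = (LINT x:D|M. g x)"
  unfolding set_lebesgue_integral_def
proof (rule integral_cong_AE)
  show "AE x in M. indicat_real D x *\<^sub>R f x = indicat_real D x *\<^sub>R g x"
    using assms(3) by eventually_elim (auto simp: indicator_def)
qed (use assms in \<open>simp_all add: set_borel_measurable_def\<close>)

lemma set_integrable_imp_measurable: "set_integrable M D f \<Longrightarrow> set_borel_measurable M D f"
  by (simp add: set_integrable_def set_borel_measurable_def)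

text \<open>
  Covers both components of vector fields and multiplication by constants.
\<close>

lemma square_integrable_bounded_linear:
  assumes L: "bounded_linear L" and f: "square_integrable_on f D"
  shows "square_integrable_on (\<lambda>x. L (f x)) D"
  unfolding square_integrable_on_def
proof
  have "(\<lambda>x. L (indicat_real D x *\<^sub>R f x)) \<in> borel_measurable lebesgue"
    using f borel_measurable_continuous_onI[OF bounded_linear.continuous_on[OF L continuous_on_id]]
    unfolding square_integrable_on_def set_borel_measurable_def by (auto intro: measurable_compose)
  then show m: "set_borel_measurable lebesgue D (\<lambda>x. L (f x))"
    by (simp add: set_borel_measurable_def linear_scale[OF bounded_linear.linear[OF L]])
  obtain K where K: "\<And>y. norm (L y) \<le> norm y * K" using bounded_linear.bounded[OF L] by blast
  have "(norm (L y))\<^sup>2 \<le> K\<^sup>2 * (norm y)\<^sup>2" for y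
    using power_mono[OF K norm_ge_zero, of y 2] by (simp add: power_mult_distrib mult.commute)
  moreover have "set_borel_measurable lebesgue D (\<lambda>x. (norm (L (f x)))\<^sup>2)"
  proof -
    have "(\<lambda>x. (norm (indicat_real D x *\<^sub>R L (f x)))\<^sup>2) \<in> borel_measurable lebesgue"
      using m unfolding set_borel_measurable_def
      by (intro borel_measurable_power measurable_compose[OF _ borel_measurable_norm])
    also have "(\<lambda>x. (norm (indicat_real D x *\<^sub>R L (f x)))\<^sup>2) = (\<lambda>x. indicat_real D x *\<^sub>R (norm (L (f x)))\<^sup>2)"
      by (auto simp: indicator_def)
    finally show ?thesis by (simp add: set_borel_measurable_def)
  qed
  moreover have "set_integrable lebesgue D (\<lambda>x. K\<^sup>2 * (norm (f x))\<^sup>2)"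
    using f by (simp add: square_integrable_on_def)
  ultimately show "set_integrable lebesgue D (\<lambda>x. (norm (L (f x)))\<^sup>2)"
    by (elim set_integrable_bound) (simp_all add: abs_mult)
qed

lemma square_integrable_add:
  assumes f: "square_integrable_on f D" and g: "square_integrable_on g D"
  shows "square_integrable_on (\<lambda>x. f x + g x) D"
  unfolding square_integrable_on_def
proof
  have m: "(\<lambda>x. indicat_real D x *\<^sub>R (f x + g x)) \<in> borel_measurable lebesgue"
    using f g unfolding square_integrable_on_def set_borel_measurable_def scaleR_add_right
    by (intro borel_measurable_add) simp_all
  then show "set_borel_measurable lebesgue D (\<lambda>x. f x + g x)" by (simp add: set_borel_measurable_def)
  have "(norm (y + z))\<^sup>2 \<le> 2 * (norm y)\<^sup>2 + 2 * (norm z)\<^sup>2" for y z :: 'a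
  proof -
    have "(norm (y + z))\<^sup>2 \<le> (norm y + norm z)\<^sup>2" by (intro power_mono norm_triangle_ineq) simp
    also have "\<dots> \<le> 2 * (norm y)\<^sup>2 + 2 * (norm z)\<^sup>2"
      using sum_squares_bound[of "norm y" "norm z"] by (simp add: power2_sum)
    finally show ?thesis .
  qed
  moreover have "set_borel_measurable lebesgue D (\<lambda>x. (norm (f x + g x))\<^sup>2)"
  proof -
    have "(\<lambda>x. (norm (indicat_real D x *\<^sub>R (f x + g x)))\<^sup>2) \<in> borel_measurable lebesgue"
      using m by (intro borel_measurable_power measurable_compose[OF _ borel_measurable_norm])
    also have "(\<lambda>x. (norm (indicat_real D x *\<^sub>R (f x + g x)))\<^sup>2) = (\<lambda>x. indicat_real D x *\<^sub>R (norm (f x + g x))\<^sup>2)"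
      by (auto simp: indicator_def)
    finally show ?thesis by (simp add: set_borel_measurable_def)
  qed
  moreover have "set_integrable lebesgue D (\<lambda>x. 2 * (norm (f x))\<^sup>2 + 2 * (norm (g x))\<^sup>2)"
    using f g by (simp add: square_integrable_on_def)
  ultimately show "set_integrable lebesgue D (\<lambda>x. (norm (f x + g x))\<^sup>2)"
    by (elim set_integrable_bound) simp_all
qed

lemma square_integrable_subset:
  "\<lbrakk>square_integrable_on f D; E \<in> sets lebesgue; E \<subseteq> D\<rbrakk> \<Longrightarrow> square_integrable_on f E"
  unfolding square_integrable_on_def using set_borel_measurable_subset set_integrable_subset by blast

text \<open>
  The product is dominated by the sum of the squares.
\<close>

lemma square_integrable_mult_cnj:
  fixes f g :: "point \<Rightarrow> complex"
  assumes f: "square_integrable_on f D" and g: "square_integrable_on g D"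
  shows "set_integrable lebesgue D (\<lambda>x. f x * cnj (g x))"
proof (rule set_integrable_bound)
  show "set_integrable lebesgue D (\<lambda>x. (norm (f x))\<^sup>2 + (norm (g x))\<^sup>2)"
    using f g by (simp add: square_integrable_on_def)
  have "(\<lambda>x. (indicat_real D x *\<^sub>R f x) * cnj (indicat_real D x *\<^sub>R g x)) \<in> borel_measurable lebesgue"
    using f g unfolding square_integrable_on_def set_borel_measurable_def
    by (intro borel_measurable_times measurable_compose[OF _ borel_measurable_continuous_onI[OF continuous_on_cnj[OF continuous_on_id]]]) simp_all
  also have "(\<lambda>x. (indicat_real D x *\<^sub>R f x) * cnj (indicat_real D x *\<^sub>R g x)) = (\<lambda>x. indicat_real D x *\<^sub>R (f x * cnj (g x)))"
    by (auto simp: indicator_def)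
  finally show "set_borel_measurable lebesgue D (\<lambda>x. f x * cnj (g x))"
    by (simp add: set_borel_measurable_def)
  have "cmod y * cmod z \<le> (cmod y)\<^sup>2 + (cmod z)\<^sup>2" for y z
    using sum_squares_bound[of "cmod y" "cmod z"] mult_nonneg_nonneg[OF norm_ge_zero norm_ge_zero, of y z] by linarith
  then show "AE x in lebesgue. x \<in> D \<longrightarrow> norm (f x * cnj (g x)) \<le> norm ((cmod (f x))\<^sup>2 + (cmod (g x))\<^sup>2)"
    by (simp add: norm_mult)
qed

lemma square_integrable_imp_integrable:
  assumes f: "square_integrable_on f D" and D: "D \<in> sets lebesgue" "emeasure lebesgue D < \<infinity>"
  shows "set_integrable lebesgue D f"
proof (rule set_integrable_bound)
  have "set_integrable lebesgue D (\<lambda>x. 1 :: real)"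
    using D by (simp add: set_integrable_def)
  then show "set_integrable lebesgue D (\<lambda>x. 1 + (norm (f x))\<^sup>2)"
    using f by (simp add: square_integrable_on_def)
  show "set_borel_measurable lebesgue D f" using f by (simp add: square_integrable_on_def)
  have "norm y \<le> 1 + (norm y)\<^sup>2" for y :: 'a
    using sum_squares_bound[of 1 "norm y"] norm_ge_zero[of y] by (simp del: norm_ge_zero)
  then show "AE x in lebesgue. x \<in> D \<longrightarrow> norm (f x) \<le> norm (1 + (norm (f x))\<^sup>2)" by simp
qed

lemma bounded_open_lebesgue:
  assumes "open \<Omega>" "bounded \<Omega>"
  shows "\<Omega> \<in> sets lebesgue" "emeasure lebesgue \<Omega> < \<infinity>"
  using assms emeasure_bounded_finite[of \<Omega>] by (simp_all add: emeasure_completion)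

lemma set_integrable_continuous_scaleR:
  fixes f :: "point \<Rightarrow> complex"
  assumes \<psi>: "continuous_on UNIV \<psi>" and "bounded D" and f: "set_integrable lebesgue D f"
  shows "set_integrable lebesgue D (\<lambda>x. \<psi> x *\<^sub>R f x)"
proof -
  have "compact (\<psi> ` closure D)"
    using assms(2) continuous_on_subset[OF \<psi>] by (intro compact_continuous_image) (auto simp: compact_closure)
  then obtain K where K: "\<And>x. x \<in> closure D \<Longrightarrow> norm (\<psi> x) \<le> K"
    using compact_imp_bounded bounded_iff by (metis imageI)
  have "set_borel_measurable lebesgue D (\<lambda>x. \<psi> x *\<^sub>R f x)"
  proof -
    have "(\<lambda>x. \<psi> x *\<^sub>R (indicat_real D x *\<^sub>R f x)) \<in> borel_measurable lebesgue"
      using f unfolding set_integrable_def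
      by (intro borel_measurable_scaleR[OF continuous_imp_lebesgue_measurable[OF \<psi>]] borel_measurable_integrable)
    then show ?thesis by (simp add: set_borel_measurable_def mult.commute)
  qed
  moreover have "norm (\<psi> x *\<^sub>R f x) \<le> norm (\<bar>K\<bar> *\<^sub>R f x)" if "x \<in> D" for x
    using K[of x] that closure_subset[of D] by (auto intro!: mult_right_mono)
  moreover have "set_integrable lebesgue D (\<lambda>x. \<bar>K\<bar> *\<^sub>R f x)"
  proof (cases "K = 0")
    case False
    then show ?thesis using f by (intro set_integrable_scaleR_right) auto
  qed (simp add: set_integrable_def)
  ultimately show ?thesis by (elim set_integrable_bound) simp_all
qed

section \<open>Weak gradients\<close>

lemma test_function_continuous:
  assumes "test_function \<Omega> \<phi>"
  shows "continuous_on UNIV \<phi>" "continuous_on UNIV (partial_deriv i \<phi>)"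
proof -
  have "foldr partial_deriv is \<phi> differentiable_on UNIV" for "is"
    using assms by (simp add: test_function_def)
  from this[of "[]"] this[of "[i]"] show "continuous_on UNIV \<phi>" "continuous_on UNIV (partial_deriv i \<phi>)"
    by (simp_all add: differentiable_imp_continuous_on)
qed

lemma test_function_zero_outside:
  assumes \<phi>: "test_function \<Omega> \<phi>" and x: "x \<notin> \<Omega>"
  shows "\<phi> x = 0" "partial_deriv i \<phi> x = 0"
proof -
  have nx: "x \<in> - closure {x. \<phi> x \<noteq> 0}" using assms by (auto simp: test_function_def)
  then show "\<phi> x = 0" using closure_subset[of "{x. \<phi> x \<noteq> 0}"] by auto
  have "(\<phi> has_derivative (\<lambda>_. 0)) (at x)"
  proof (rule has_derivative_transform_within_open[of "\<lambda>_. 0"])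
    show "open (- closure {x. \<phi> x \<noteq> 0})" by (rule open_Compl) simp
    show "0 = \<phi> y" if "y \<in> - closure {x. \<phi> x \<noteq> 0}" for y
      using that closure_subset[of "{x. \<phi> x \<noteq> 0}"] by auto
  qed (use nx in simp_all)
  then show "partial_deriv i \<phi> x = 0"
    unfolding partial_deriv_def by (metis frechet_derivative_at)
qed

lemma test_function_mono: "test_function U \<phi> \<Longrightarrow> U \<subseteq> \<Omega> \<Longrightarrow> test_function \<Omega> \<phi>"
  by (auto simp: test_function_def)

lemma weak_gradient_integrable:
  assumes "is_weak_gradient \<Omega> v g" "open \<Omega>" "bounded \<Omega>"
  shows "set_integrable lebesgue \<Omega> (\<lambda>x. g x $ i)"
proof -
  have "square_integrable_on g \<Omega>" using assms(1) unfolding is_weak_gradient_def by blast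
  then show ?thesis
    using bounded_open_lebesgue[OF assms(2,3)]
    by (intro square_integrable_imp_integrable square_integrable_bounded_linear[OF bounded_linear_vec_nth])
qed

lemma weak_gradientD:
  assumes "is_weak_gradient \<Omega> v g" "test_function \<Omega> \<phi>"
  shows "(LINT x:\<Omega>|lebesgue. partial_deriv i \<phi> x *\<^sub>R v x) = - (LINT x:\<Omega>|lebesgue. \<phi> x *\<^sub>R (g x $ i))"
  using assms unfolding is_weak_gradient_def by blast

text \<open>
  A test function supported in \<open>U\<close> sees \<open>v\<close> and \<open>w\<close> only through their values in \<open>U\<close>. The choice \<open>U = \<Omega>\<close> and
  \<open>v = w\<close> gives uniqueness of the weak gradient, and comparison with the zero function gives its locality.
\<close>

lemma weak_gradient_unique:
  assumes \<Omega>: "open \<Omega>" "bounded \<Omega>" and U: "open U" "U \<subseteq> \<Omega>"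
    and g: "is_weak_gradient \<Omega> v g" and h: "is_weak_gradient \<Omega> w h"
    and vw: "\<And>x. x \<in> U \<Longrightarrow> v x = w x"
  shows "AE x in lebesgue. x \<in> U \<longrightarrow> g x = h x"
proof -
  have gi: "set_integrable lebesgue \<Omega> (\<lambda>x. g x $ i)" and hi: "set_integrable lebesgue \<Omega> (\<lambda>x. h x $ i)" for i
    by (rule weak_gradient_integrable[OF g \<Omega>], rule weak_gradient_integrable[OF h \<Omega>])
  have "AE x in lebesgue. x \<in> U \<longrightarrow> g x $ i - h x $ i = 0" for i
  proof (rule fundamental_lemma[OF U(1)])
    show "set_integrable lebesgue U (\<lambda>x. g x $ i - h x $ i)"
      using set_integral_diff(1)[OF gi[of i] hi[of i]] U by (elim set_integrable_subset) auto
    fix \<phi> assume \<phi>U: "test_function U \<phi>"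
    then have \<phi>: "test_function \<Omega> \<phi>" using U test_function_mono by blast
    have "(LINT x:U|lebesgue. \<phi> x *\<^sub>R (g x $ i - h x $ i)) = (LINT x:\<Omega>|lebesgue. \<phi> x *\<^sub>R (g x $ i - h x $ i))"
      unfolding set_lebesgue_integral_def using test_function_zero_outside(1)[OF \<phi>U] U(2)
      by (intro Bochner_Integration.integral_cong refl) (auto simp: indicator_def)
    also have "\<dots> = (LINT x:\<Omega>|lebesgue. \<phi> x *\<^sub>R (g x $ i)) - (LINT x:\<Omega>|lebesgue. \<phi> x *\<^sub>R (h x $ i))"
      unfolding scaleR_diff_right
      by (intro set_integral_diff set_integrable_continuous_scaleR test_function_continuous[OF \<phi>] \<Omega> gi hi)
    also have "\<dots> = (LINT x:\<Omega>|lebesgue. partial_deriv i \<phi> x *\<^sub>R w x) - (LINT x:\<Omega>|lebesgue. partial_deriv i \<phi> x *\<^sub>R v x)"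
      unfolding weak_gradientD[OF g \<phi>] weak_gradientD[OF h \<phi>] by simp
    also have "\<dots> = 0"
    proof -
      have "partial_deriv i \<phi> x *\<^sub>R w x = partial_deriv i \<phi> x *\<^sub>R v x" for x
        using test_function_zero_outside(2)[OF \<phi>U, of x i] vw[of x] by (cases "x \<in> U") auto
      then show ?thesis by (simp only: diff_self)
    qed
    finally show "(LINT x:U|lebesgue. \<phi> x *\<^sub>R (g x $ i - h x $ i)) = 0" .
  qed
  then have "AE x in lebesgue. \<forall>i\<in>UNIV. x \<in> U \<longrightarrow> g x $ i - h x $ i = 0"
    by (intro AE_finite_allI) simp_all
  then show ?thesis by eventually_elim (simp add: vec_eq_iff)
qed

lemma weak_gradient_add:
  assumes \<Omega>: "open \<Omega>" "bounded \<Omega>"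
    and v: "square_integrable_on v \<Omega>" "is_weak_gradient \<Omega> v g"
    and w: "square_integrable_on w \<Omega>" "is_weak_gradient \<Omega> w h"
  shows "is_weak_gradient \<Omega> (\<lambda>x. v x + w x) (\<lambda>x. g x + h x)"
  unfolding is_weak_gradient_def
proof (intro conjI allI impI)
  show "square_integrable_on (\<lambda>x. g x + h x) \<Omega>"
    using v w by (simp add: is_weak_gradient_def square_integrable_add)
  fix \<phi> i assume \<phi>: "test_function \<Omega> \<phi>"
  have vi: "set_integrable lebesgue \<Omega> v" "set_integrable lebesgue \<Omega> w"
    using v w square_integrable_imp_integrable bounded_open_lebesgue[OF \<Omega>] by blast+
  have gi: "set_integrable lebesgue \<Omega> (\<lambda>x. g x $ i)" "set_integrable lebesgue \<Omega> (\<lambda>x. h x $ i)"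
    by (rule weak_gradient_integrable[OF v(2) \<Omega>], rule weak_gradient_integrable[OF w(2) \<Omega>])
  have "(LINT x:\<Omega>|lebesgue. partial_deriv i \<phi> x *\<^sub>R v x + partial_deriv i \<phi> x *\<^sub>R w x) =
          (LINT x:\<Omega>|lebesgue. partial_deriv i \<phi> x *\<^sub>R v x) + (LINT x:\<Omega>|lebesgue. partial_deriv i \<phi> x *\<^sub>R w x)"
    by (intro set_integral_add set_integrable_continuous_scaleR test_function_continuous[OF \<phi>] \<Omega> vi)
  moreover have "(LINT x:\<Omega>|lebesgue. \<phi> x *\<^sub>R (g x $ i) + \<phi> x *\<^sub>R (h x $ i)) =
          (LINT x:\<Omega>|lebesgue. \<phi> x *\<^sub>R (g x $ i)) + (LINT x:\<Omega>|lebesgue. \<phi> x *\<^sub>R (h x $ i))"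
    by (intro set_integral_add set_integrable_continuous_scaleR test_function_continuous[OF \<phi>] \<Omega> gi)
  ultimately show "(LINT x:\<Omega>|lebesgue. partial_deriv i \<phi> x *\<^sub>R (v x + w x)) =
      - (LINT x:\<Omega>|lebesgue. \<phi> x *\<^sub>R ((g x + h x) $ i))"
    unfolding scaleR_add_right vector_add_component
    using weak_gradientD[OF v(2) \<phi>, of i] weak_gradientD[OF w(2) \<phi>, of i] by simp
qed

lemma bounded_linear_scale_components: "bounded_linear (\<lambda>y :: complex^2. \<chi> i. c * y $ i)"
  by (intro linear_linear[THEN iffD2] linearI) (simp_all add: vec_eq_iff algebra_simps)

lemma weak_gradient_scale:
  assumes "is_weak_gradient \<Omega> v g"
  shows "is_weak_gradient \<Omega> (\<lambda>x. c * v x) (\<lambda>x. \<chi> i. c * g x $ i)"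
  unfolding is_weak_gradient_def
proof (intro conjI allI impI)
  show "square_integrable_on (\<lambda>x. \<chi> i. c * g x $ i) \<Omega>"
    using assms unfolding is_weak_gradient_def
    by (intro square_integrable_bounded_linear[OF bounded_linear_scale_components]) simp
  fix \<phi> i assume \<phi>: "test_function \<Omega> \<phi>"
  show "(LINT x:\<Omega>|lebesgue. partial_deriv i \<phi> x *\<^sub>R (c * v x)) =
      - (LINT x:\<Omega>|lebesgue. \<phi> x *\<^sub>R ((\<chi> i. c * g x $ i) $ i))"
    using weak_gradientD[OF assms \<phi>, of i] by (simp flip: mult_scaleR_right)
qed

lemma weak_grad_H1: "v \<in> H1 \<Omega> \<Longrightarrow> is_weak_gradient \<Omega> v (weak_grad \<Omega> v)"
  unfolding H1_def weak_grad_def by (auto intro: someI[of "is_weak_gradient \<Omega> v"])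

lemma function_space_H1:
  assumes "open \<Omega>" "bounded \<Omega>"
  shows "function_space (H1 \<Omega>)"
proof
  have "square_integrable_on (\<lambda>x. 0 :: complex^2) \<Omega>" "square_integrable_on (\<lambda>x. 0 :: complex) \<Omega>"
    by (simp_all add: square_integrable_on_def set_integrable_def set_borel_measurable_def)
  then show "(\<lambda>_. 0) \<in> H1 \<Omega>" by (auto simp: H1_def is_weak_gradient_def intro!: exI[of _ "\<lambda>_. 0"])
  show "(\<lambda>x. v x + w x) \<in> H1 \<Omega>" if "v \<in> H1 \<Omega>" "w \<in> H1 \<Omega>" for v w
    using that square_integrable_add weak_gradient_add[OF assms] unfolding H1_def by blast
  show "(\<lambda>x. c * v x) \<in> H1 \<Omega>" if "v \<in> H1 \<Omega>" for v c
    using that weak_gradient_scale square_integrable_bounded_linear[OF bounded_linear_mult_right, of v \<Omega> c]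
    unfolding H1_def by blast
qed

text \<open>
  The representatives chosen by \<open>weak_grad\<close> for different functions are unrelated, so linearity can
  only hold almost everywhere. It is a consequence of uniqueness.
\<close>

lemma weak_grad_linear:
  assumes \<Omega>: "open \<Omega>" "bounded \<Omega>" and "v \<in> H1 \<Omega>"
  shows "w \<in> H1 \<Omega> \<Longrightarrow> AE x in lebesgue. x \<in> \<Omega> \<longrightarrow>
            weak_grad \<Omega> (\<lambda>x. v x + w x) x = weak_grad \<Omega> v x + weak_grad \<Omega> w x"
    and "AE x in lebesgue. x \<in> \<Omega> \<longrightarrow> weak_grad \<Omega> (\<lambda>x. c * v x) x = (\<chi> i. c * weak_grad \<Omega> v x $ i)"
proof -
  interpret function_space "H1 \<Omega>" by (rule function_space_H1[OF \<Omega>])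
  show "AE x in lebesgue. x \<in> \<Omega> \<longrightarrow> weak_grad \<Omega> (\<lambda>x. c * v x) x = (\<chi> i. c * weak_grad \<Omega> v x $ i)"
    by (rule weak_gradient_unique[OF \<Omega> \<Omega>(1) order_refl weak_grad_H1[OF scale_mem[OF assms(3)]]
        weak_gradient_scale[OF weak_grad_H1[OF assms(3)]] refl])
  assume w: "w \<in> H1 \<Omega>"
  have "is_weak_gradient \<Omega> (\<lambda>x. v x + w x) (\<lambda>x. weak_grad \<Omega> v x + weak_grad \<Omega> w x)"
    using weak_gradient_add[OF \<Omega> _ weak_grad_H1[OF assms(3)] _ weak_grad_H1[OF w]] assms(3) w
    by (simp add: H1_def)
  then show "AE x in lebesgue. x \<in> \<Omega> \<longrightarrow>
            weak_grad \<Omega> (\<lambda>x. v x + w x) x = weak_grad \<Omega> v x + weak_grad \<Omega> w x"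
    by (rule weak_gradient_unique[OF \<Omega> \<Omega>(1) order_refl weak_grad_H1[OF add_mem[OF assms(3) w]] _ refl])
qed

lemma weak_grad_zero_on_open:
  assumes \<Omega>: "open \<Omega>" "bounded \<Omega>" and U: "open U" "U \<subseteq> \<Omega>" and v: "v \<in> H1 \<Omega>" "\<And>x. x \<in> U \<Longrightarrow> v x = 0"
  shows "AE x in lebesgue. x \<in> U \<longrightarrow> weak_grad \<Omega> v x = 0"
proof (rule weak_gradient_unique[OF \<Omega> U weak_grad_H1[OF v(1)], of "\<lambda>_. 0" "\<lambda>_. 0"])
  show "is_weak_gradient \<Omega> (\<lambda>_. 0) (\<lambda>_. 0)"
    by (simp add: is_weak_gradient_def square_integrable_on_def set_integrable_def set_borel_measurable_def)
qed (use v(2) in simp)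

section \<open>The volume forms\<close>

lemma hermitian_form_cong:
  assumes "hermitian_form S b" "\<And>v w. v \<in> S \<Longrightarrow> w \<in> S \<Longrightarrow> b' v w = b v w"
  shows "hermitian_form S b'"
proof -
  interpret hermitian_form S b by fact
  have eq: "b' v w = b v w" if "v \<in> S" "w \<in> S" for v w using assms(2) that by blast
  show ?thesis
  proof
    show "b' (\<lambda>x. u x + v x) w = b' u w + b' v w" if "u \<in> S" "v \<in> S" "w \<in> S" for u v w
      using that form_add[OF that] add_mem[of u v] by (simp add: eq)
    show "b' (\<lambda>x. c * v x) w = c * b' v w" if "v \<in> S" "w \<in> S" for v w c
      using that form_scale[OF that] scale_mem[of v c] by (simp add: eq)
    show "b' v w = cnj (b' w v)" if "v \<in> S" "w \<in> S" for v w
      unfolding eq[OF that] eq[OF that(2,1)] by (rule form_cnj[OF that])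
    show "0 \<le> Re (b' v v)" if "v \<in> S" for v
      using form_nonneg[OF that] by (simp add: eq that)
  qed
qed

lemma hermitian_form_add_scaled:
  assumes "hermitian_form S a" "hermitian_form S b" "0 \<le> c"
  shows "hermitian_form S (\<lambda>v w. a v w + of_real c * b v w)"
proof -
  interpret A: hermitian_form S a by fact
  interpret B: hermitian_form S b by fact
  show ?thesis
  proof
    show "a v w + of_real c * b v w = cnj (a w v + of_real c * b w v)" if "v \<in> S" "w \<in> S" for v w
      unfolding A.form_cnj[OF that] B.form_cnj[OF that] by simp
  qed (use assms(3) in \<open>simp_all add: A.form_add B.form_add A.form_scale B.form_scale A.form_nonneg B.form_nonneg
      algebra_simps\<close>)
qed

text \<open>
  Integrability is essential here: a non-integrable product has integral 0 by convention, which would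
  destroy additivity.
\<close>

lemma hermitian_form_integral:
  assumes "function_space S"
    and int: "\<And>v w. v \<in> S \<Longrightarrow> w \<in> S \<Longrightarrow> set_integrable M D (\<lambda>x. v x * cnj (w x))"
  shows "hermitian_form S (\<lambda>v w. LINT x:D|M. v x * cnj (w x))"
proof -
  interpret function_space S by fact
  show ?thesis
  proof
    show "(LINT x:D|M. (u x + v x) * cnj (w x)) = (LINT x:D|M. u x * cnj (w x)) + (LINT x:D|M. v x * cnj (w x))"
      if "u \<in> S" "v \<in> S" "w \<in> S" for u v w
      using set_integral_add(2)[OF int[OF that(1,3)] int[OF that(2,3)]] by (simp only: distrib_right)
    show "(LINT x:D|M. c * v x * cnj (w x)) = c * (LINT x:D|M. v x * cnj (w x))" for v w c
      by (simp add: mult.assoc)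
    show "(LINT x:D|M. v x * cnj (w x)) = cnj (LINT x:D|M. w x * cnj (v x))" for v w
      unfolding set_lebesgue_integral_def Bochner_Integration.integral_cnj[symmetric] by (simp add: mult.commute)
    show "0 \<le> Re (LINT x:D|M. v x * cnj (v x))" for v
      unfolding complex_norm_square[symmetric] set_integral_complex_of_real
      by (simp add: set_lebesgue_integral_def)
  qed
qed

lemma hermitian_form_L2:
  assumes "function_space S" "\<And>v. v \<in> S \<Longrightarrow> square_integrable_on v D"
  shows "hermitian_form S (L2_inner D)"
proof -
  have "hermitian_form S (\<lambda>v w. LINT x:D|lebesgue. v x * cnj (w x))"
    by (intro hermitian_form_integral assms square_integrable_mult_cnj)
  then show ?thesis by (rule hermitian_form_cong) (simp add: L2_inner_def)
qed

lemma function_space_square_integrable: "function_space {v :: cfun. square_integrable_on v D}"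
proof
  show "(\<lambda>_. 0) \<in> {v :: cfun. square_integrable_on v D}"
    by (simp add: square_integrable_on_def set_integrable_def set_borel_measurable_def)
qed (auto intro: square_integrable_add square_integrable_bounded_linear[OF bounded_linear_mult_right])

definition grad_dot :: "(point \<Rightarrow> complex^2) \<Rightarrow> (point \<Rightarrow> complex^2) \<Rightarrow> point \<Rightarrow> complex" where
  "grad_dot g h x = (\<Sum>i\<in>UNIV. g x $ i * cnj (h x $ i))"

lemma set_integrable_grad_dot:
  assumes "square_integrable_on g D" "square_integrable_on h D"
  shows "set_integrable lebesgue D (grad_dot g h)"
proof -
  have "square_integrable_on (\<lambda>x. g x $ i) D" "square_integrable_on (\<lambda>x. h x $ i) D" for i
    using assms by (auto intro: square_integrable_bounded_linear[OF bounded_linear_vec_nth])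
  then have "set_integrable lebesgue D (\<lambda>x. g x $ i * cnj (h x $ i))" for i
    by (rule square_integrable_mult_cnj)
  then show ?thesis
    unfolding set_integrable_def grad_dot_def scaleR_sum_right by (intro Bochner_Integration.integrable_sum)
qed

lemma grad_dot_diag: "grad_dot g g = (\<lambda>x. of_real (\<Sum>i\<in>UNIV. (cmod (g x $ i))\<^sup>2))"
  by (rule ext) (simp only: grad_dot_def of_real_sum complex_norm_square)

lemma grad_inner_eq:
  "grad_inner P D v w = (LINT x:D|lebesgue. grad_dot (weak_grad (Omega P) v) (weak_grad (Omega P) w) x)"
  by (simp add: grad_inner_def grad_dot_def)

lemma weak_grad_square_integrable:
  assumes "v \<in> H1 \<Omega>" "D \<in> sets lebesgue" "D \<subseteq> \<Omega>"
  shows "square_integrable_on (weak_grad \<Omega> v) D"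
  using weak_grad_H1[OF assms(1)] assms(2,3) unfolding is_weak_gradient_def
  by (auto intro: square_integrable_subset)

text \<open>
  The integrands of the two sides agree only almost everywhere, since weak gradients are linear only almost everywhere.
\<close>

lemma hermitian_form_grad:
  assumes \<Omega>: "open (Omega P)" "bounded (Omega P)" and D: "D \<in> sets lebesgue" "D \<subseteq> Omega P"
  shows "hermitian_form (H1 (Omega P)) (grad_inner P D)"
proof -
  interpret function_space "H1 (Omega P)" by (rule function_space_H1[OF \<Omega>])
  let ?g = "weak_grad (Omega P)"
  have int: "set_integrable lebesgue D (grad_dot (?g v) (?g w))" if "v \<in> H1 (Omega P)" "w \<in> H1 (Omega P)" for v w
    using that by (intro set_integrable_grad_dot weak_grad_square_integrable D)
  show ?thesis
  proof
    fix u v w assume u: "u \<in> H1 (Omega P)" and v: "v \<in> H1 (Omega P)" and w: "w \<in> H1 (Omega P)"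
    have "grad_inner P D (\<lambda>x. u x + v x) w = (LINT x:D|lebesgue. grad_dot (?g u) (?g w) x + grad_dot (?g v) (?g w) x)"
      unfolding grad_inner_eq
    proof (rule set_LINT_cong_AE)
      show "set_borel_measurable lebesgue D (grad_dot (?g (\<lambda>x. u x + v x)) (?g w))"
        "set_borel_measurable lebesgue D (\<lambda>x. grad_dot (?g u) (?g w) x + grad_dot (?g v) (?g w) x)"
        by (intro set_integrable_imp_measurable int set_integral_add(1) add_mem u v w)+
      show "AE x in lebesgue. x \<in> D \<longrightarrow>
          grad_dot (?g (\<lambda>x. u x + v x)) (?g w) x = grad_dot (?g u) (?g w) x + grad_dot (?g v) (?g w) x"
        using weak_grad_linear(1)[OF \<Omega> u v]
        by eventually_elim (use D(2) in \<open>auto simp: grad_dot_def distrib_right sum.distrib\<close>)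
    qed
    then show "grad_inner P D (\<lambda>x. u x + v x) w = grad_inner P D u w + grad_inner P D v w"
      unfolding grad_inner_eq using set_integral_add(2)[OF int[OF u w] int[OF v w]] by simp
  next
    fix v w c assume v: "v \<in> H1 (Omega P)" and w: "w \<in> H1 (Omega P)"
    have "grad_inner P D (\<lambda>x. c * v x) w = (LINT x:D|lebesgue. c * grad_dot (?g v) (?g w) x)"
      unfolding grad_inner_eq
    proof (rule set_LINT_cong_AE)
      show "set_borel_measurable lebesgue D (grad_dot (?g (\<lambda>x. c * v x)) (?g w))"
        "set_borel_measurable lebesgue D (\<lambda>x. c * grad_dot (?g v) (?g w) x)"
        by (intro set_integrable_imp_measurable int set_integrable_mult_right scale_mem v w)+
      show "AE x in lebesgue. x \<in> D \<longrightarrow> grad_dot (?g (\<lambda>x. c * v x)) (?g w) x = c * grad_dot (?g v) (?g w) x"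
        using weak_grad_linear(2)[OF \<Omega> v, of c]
        by eventually_elim (use D(2) in \<open>auto simp: grad_dot_def sum_distrib_left mult.assoc\<close>)
    qed
    then show "grad_inner P D (\<lambda>x. c * v x) w = c * grad_inner P D v w"
      unfolding grad_inner_eq by simp
  next
    fix v w
    show "grad_inner P D v w = cnj (grad_inner P D w v)"
      unfolding grad_inner_eq set_lebesgue_integral_def Bochner_Integration.integral_cnj[symmetric]
      by (simp add: grad_dot_def mult.commute)
    show "0 \<le> Re (grad_inner P D v v)"
      unfolding grad_inner_eq grad_dot_diag set_integral_complex_of_real
      by (simp add: set_lebesgue_integral_def sum_nonneg)
  qed
qed

lemma hermitian_form_b_on:
  assumes \<Omega>: "open (Omega P)" "bounded (Omega P)" and D: "D \<in> sets lebesgue" "D \<subseteq> Omega P"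
  shows "hermitian_form (H1 (Omega P)) (b_on P D)"
proof -
  have "hermitian_form (H1 (Omega P)) (L2_inner D)"
    using function_space_H1[OF \<Omega>] by (rule hermitian_form_L2) (auto simp: H1_def intro: square_integrable_subset[OF _ D])
  from hermitian_form_add_scaled[OF hermitian_form_grad[OF assms] this zero_le_power2[of "wavenumber P"]]
  show ?thesis by (rule hermitian_form_cong) (simp add: b_on_def)
qed

lemma energy_norm_on_eq_integral:
  "(energy_norm_on P D v)\<^sup>2 = (LINT x:D|lebesgue. (\<Sum>i\<in>UNIV. (cmod (weak_grad (Omega P) v x $ i))\<^sup>2))
     + (wavenumber P)\<^sup>2 * (LINT x:D|lebesgue. (cmod (v x))\<^sup>2)"
    (is "_ = ?G + _ * ?L")
proof -
  have "grad_inner P D v v = of_real ?G"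
    unfolding grad_inner_eq grad_dot_diag set_integral_complex_of_real ..
  moreover have "L2_inner D v v = of_real ?L"
    unfolding L2_inner_def complex_norm_square[symmetric] set_integral_complex_of_real ..
  moreover have "0 \<le> ?G" "0 \<le> ?L" by (simp_all add: set_lebesgue_integral_def sum_nonneg)
  ultimately show ?thesis by (simp add: energy_norm_on_def b_on_def flip: of_real_power)
qed

lemma energy_norm_on_nonneg: "0 \<le> energy_norm_on P D v"
proof -
  have "0 \<le> Re (b_on P D v v)"
    unfolding b_on_def grad_inner_eq grad_dot_diag set_integral_complex_of_real L2_inner_def
      complex_norm_square[symmetric]
    by (simp add: set_lebesgue_integral_def sum_nonneg flip: of_real_power)
  then show ?thesis by (simp add: energy_norm_on_def)
qed

lemma energy_norm_on_mono:
  assumes D: "D \<in> sets lebesgue" "D \<subseteq> E" "E \<in> sets lebesgue" "E \<subseteq> Omega P" and v: "v \<in> H1 (Omega P)"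
  shows "energy_norm_on P D v \<le> energy_norm_on P E v"
proof -
  have mono: "(LINT x:D|lebesgue. f x) \<le> (LINT x:E|lebesgue. f x)"
    if f: "set_integrable lebesgue E f" "\<And>x. 0 \<le> f x" for f :: "point \<Rightarrow> real"
    unfolding set_lebesgue_integral_def
  proof (rule Bochner_Integration.integral_mono)
    show "indicat_real D x *\<^sub>R f x \<le> indicat_real E x *\<^sub>R f x" for x
      using f(2)[of x] D(2) by (auto simp: indicator_def)
  qed (use f(1) set_integrable_subset[OF f(1) D(1,2)] in \<open>simp_all only: set_integrable_def\<close>)
  have "set_integrable lebesgue E (\<lambda>x. (cmod (weak_grad (Omega P) v x $ i))\<^sup>2)" for i
    using square_integrable_bounded_linear[OF bounded_linear_vec_nth weak_grad_square_integrable[OF v D(3,4)], of i]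
    by (simp add: square_integrable_on_def)
  then have "set_integrable lebesgue E (\<lambda>x. \<Sum>i\<in>UNIV. (cmod (weak_grad (Omega P) v x $ i))\<^sup>2)"
    unfolding set_integrable_def scaleR_sum_right by (intro Bochner_Integration.integrable_sum)
  moreover have "set_integrable lebesgue E (\<lambda>x. (cmod (v x))\<^sup>2)"
    using v square_integrable_subset[OF _ D(3,4)] by (auto simp: H1_def square_integrable_on_def)
  ultimately have "(energy_norm_on P D v)\<^sup>2 \<le> (energy_norm_on P E v)\<^sup>2"
    unfolding energy_norm_on_eq_integral by (intro add_mono mult_left_mono mono) (simp_all add: sum_nonneg)
  then show ?thesis by (rule power2_le_imp_le) (rule energy_norm_on_nonneg)
qed

lemma square_integral_zero_imp_AE:
  fixes v :: cfun
  assumes v: "square_integrable_on v D" and "L2_inner D v v = 0"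
  shows "AE x in lebesgue. x \<in> D \<longrightarrow> v x = 0"
proof -
  have "(LINT x:D|lebesgue. (cmod (v x))\<^sup>2) = 0"
    using assms(2) unfolding L2_inner_def complex_norm_square[symmetric] set_integral_complex_of_real by simp
  moreover have "integrable lebesgue (\<lambda>x. indicat_real D x *\<^sub>R (cmod (v x))\<^sup>2)"
    using v by (simp add: square_integrable_on_def set_integrable_def)
  ultimately have "AE x in lebesgue. indicat_real D x *\<^sub>R (cmod (v x))\<^sup>2 = 0"
    unfolding set_lebesgue_integral_def by (subst integral_nonneg_eq_0_iff_AE[symmetric]) simp_all
  then show ?thesis by eventually_elim (auto simp: indicator_def split: if_splits)
qed

text \<open>
  Otherwise the set where \<open>v\<close> is nonzero is open, nonempty and negligible.
\<close>

lemma AE_zero_imp_zero: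
  fixes v :: cfun
  assumes "open U" "continuous_on U v" "AE x in lebesgue. x \<in> U \<longrightarrow> v x = 0" "x \<in> U"
  shows "v x = 0"
proof (rule ccontr)
  let ?N = "{x \<in> U. v x \<noteq> 0}"
  assume "v x \<noteq> 0"
  then have "?N \<noteq> {}" using assms(4) by blast
  moreover have "open ?N"
  proof -
    have "?N = U \<inter> v -` (- {0})" by auto
    then show ?thesis using continuous_open_preimage[OF assms(2,1), of "- {0}"] by (simp add: open_Compl)
  qed
  moreover have "negligible ?N"
    using assms(3) unfolding negligible_iff_null_sets completion.AE_iff_null_sets by simp
  ultimately show False using open_not_negligible by blast
qed

section \<open>The boundary form\<close>

lemma continuous_on_imp_set_borel_measurable:
  fixes v :: "point \<Rightarrow> 'b::{real_normed_vector, second_countable_topology}"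
  assumes "A \<in> sets borel" "continuous_on A v"
  shows "set_borel_measurable lebesgue A v"
  unfolding set_borel_measurable_def
  using borel_measurable_continuous_on_indicator[OF assms] by (intro measurable_completion) simp

lemma bounded_set_integrable:
  fixes v :: "'a::topological_space \<Rightarrow> 'b::{banach, second_countable_topology}"
  assumes m: "set_borel_measurable M A v" and A: "A \<in> sets M" "emeasure M A < \<infinity>"
    and K: "\<And>x. x \<in> A \<Longrightarrow> norm (v x) \<le> K"
  shows "set_integrable M A v"
proof (rule set_integrable_bound[OF _ m])
  show "set_integrable M A (\<lambda>_. K)" using A by (simp add: set_integrable_def)
  show "AE x in M. x \<in> A \<longrightarrow> norm (v x) \<le> norm K" using K by (auto intro!: AE_I2 order_trans[OF K])
qed

lemma continuous_on_closure_bounded: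
  fixes v :: "point \<Rightarrow> complex"
  assumes "bounded \<Omega>" "continuous_on (closure \<Omega>) v"
  obtains K where "\<And>x. x \<in> closure \<Omega> \<Longrightarrow> cmod (v x) \<le> K"
proof -
  have "bounded (v ` closure \<Omega>)"
    using assms compact_closure by (intro compact_imp_bounded compact_continuous_image) auto
  then show ?thesis using that unfolding bounded_iff by blast
qed

lemma continuous_imp_square_integrable:
  assumes \<Omega>: "bounded \<Omega>" "continuous_on (closure \<Omega>) v" and D: "open D" "D \<subseteq> \<Omega>"
  shows "square_integrable_on (v :: cfun) D"
  unfolding square_integrable_on_def
proof
  obtain K where K: "\<And>x. x \<in> closure \<Omega> \<Longrightarrow> cmod (v x) \<le> K"
    using continuous_on_closure_bounded[OF \<Omega>] by blast
  have sub: "D \<subseteq> closure \<Omega>" using D closure_subset by blast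
  have cont: "continuous_on D v" using \<Omega>(2) sub by (rule continuous_on_subset)
  show "set_borel_measurable lebesgue D v"
    using cont D(1) by (intro continuous_on_imp_set_borel_measurable) auto
  show "set_integrable lebesgue D (\<lambda>x. (norm (v x))\<^sup>2)"
  proof (rule bounded_set_integrable)
    show "set_borel_measurable lebesgue D (\<lambda>x. (norm (v x))\<^sup>2)"
      using cont D(1) by (intro continuous_on_imp_set_borel_measurable continuous_intros) auto
    show "D \<in> sets lebesgue" "emeasure lebesgue D < \<infinity>"
      using bounded_open_lebesgue[of D] D bounded_subset[OF \<Omega>(1)] by auto
    show "norm ((norm (v x))\<^sup>2) \<le> K\<^sup>2" if "x \<in> D" for x
      using K[of x] that sub by (auto intro!: power_mono)
  qed
qed

text \<open>
  The mean over a small ball deviates from \<open>v x\<close> by at most the oscillation of \<open>v\<close> near \<open>x\<close>; the means are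
  well defined since a ball around a point of the closure meets \<open>\<Omega>\<close> in a set of positive measure.
\<close>

lemma boundary_trace_continuous:
  assumes \<Omega>: "open \<Omega>" "bounded \<Omega>" and v: "continuous_on (closure \<Omega>) v" and x: "x \<in> closure \<Omega>"
  shows "boundary_trace \<Omega> v x = v x"
  unfolding boundary_trace_def
proof (rule tendsto_Lim)
  show "((\<lambda>r. (LINT y:(ball x r \<inter> \<Omega>)|lebesgue. v y) /\<^sub>R measure lebesgue (ball x r \<inter> \<Omega>)) \<longlongrightarrow> v x) (at_right 0)"
  proof (rule tendstoI)
    fix e :: real assume e: "e > 0"
    obtain d where d: "d > 0" "\<And>y. y \<in> closure \<Omega> \<Longrightarrow> dist y x < d \<Longrightarrow> dist (v y) (v x) < e / 2"
      using v x e unfolding continuous_on_iff by (meson half_gt_zero)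
    have "dist ((LINT y:(ball x r \<inter> \<Omega>)|lebesgue. v y) /\<^sub>R measure lebesgue (ball x r \<inter> \<Omega>)) (v x) < e"
      if r: "0 < r" "r < d" for r
    proof -
      define A where "A = ball x r \<inter> \<Omega>"
      have A: "open A" "bounded A" "A \<subseteq> closure \<Omega>"
        using \<Omega> bounded_subset[OF \<Omega>(2)] closure_subset by (auto simp: A_def)
      have "A \<noteq> {}" using x r unfolding A_def closure_approachable by (force simp: dist_commute)
      then have "measure lebesgue A > 0"
        using A(1,2) open_not_negligible[of A] negligible_iff_measure[of A] bounded_open_lebesgue[OF A(1,2)]
        by (auto simp: fmeasurable_def zero_less_measure_iff)
      moreover
      define m where "m = measure lebesgue A"
      ultimately have m: "m > 0" by simp
      have cont: "continuous_on A v" using v A(3) by (rule continuous_on_subset)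
      have Am: "A \<in> sets lebesgue" "emeasure lebesgue A < \<infinity>" by (rule bounded_open_lebesgue[OF A(1,2)])+
      have close: "norm (v y - v x) \<le> e / 2" if "y \<in> A" for y
        using that A(3) d(2)[of y] r by (auto simp: A_def dist_norm norm_minus_commute dist_commute)
      have int: "set_integrable lebesgue A (\<lambda>y. v y - v x)"
        using cont A(1) Am close
        by (intro bounded_set_integrable[where K = "e / 2"] continuous_on_imp_set_borel_measurable
            continuous_intros) auto
      have intc: "set_integrable lebesgue A (\<lambda>y. c)" for c :: "'c::{banach, second_countable_topology}"
        using Am by (simp add: set_integrable_def)
      have const: "(LINT y:A|lebesgue. c) = m *\<^sub>R c" for c :: "'c::{banach, second_countable_topology}"
        using Am by (simp add: set_lebesgue_integral_def m_def)
      have "(LINT y:A|lebesgue. v y) = (LINT y:A|lebesgue. (v y - v x) + v x)" by simp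
      also have "\<dots> = (LINT y:A|lebesgue. v y - v x) + m *\<^sub>R v x"
        unfolding set_integral_add(2)[OF int intc] const ..
      finally have "(LINT y:A|lebesgue. v y) /\<^sub>R m - v x = (LINT y:A|lebesgue. v y - v x) /\<^sub>R m"
        using m by (simp add: scaleR_add_right)
      moreover have "norm (LINT y:A|lebesgue. v y - v x) \<le> m * (e / 2)"
      proof -
        have "norm (LINT y:A|lebesgue. v y - v x) \<le> (LINT y:A|lebesgue. norm (v y - v x))"
          using int by (rule set_integral_norm_bound)
        also have "\<dots> \<le> (LINT y:A|lebesgue. e / 2)"
          using set_integrable_norm[OF int] intc close by (rule set_integral_mono)
        finally show ?thesis unfolding const by simp
      qed
      ultimately have "norm ((LINT y:A|lebesgue. v y) /\<^sub>R m - v x) \<le> e / 2"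
        using m by (simp add: field_simps)
      then show ?thesis using e by (simp add: dist_norm A_def m_def)
    qed
    then show "\<forall>\<^sub>F r in at_right 0.
        dist ((LINT y:(ball x r \<inter> \<Omega>)|lebesgue. v y) /\<^sub>R measure lebesgue (ball x r \<inter> \<Omega>)) (v x) < e"
      using d(1) by (auto simp: eventually_at_right_field)
  qed
qed simp

text \<open>
  Since \<open>measure_of\<close> assigns to a Borel set either \<open>hausdorff1\<close> or 0, an upper bound for
  \<open>hausdorff1\<close> suffices. Finitely many segments have covers by
  small balls of bounded total diameter.
\<close>

lemma arc_measure_polygonal_finite:
  assumes "polygonal \<Omega>" "\<Gamma> \<subseteq> frontier \<Omega>"
  shows "emeasure arc_measure \<Gamma> < \<infinity>"
proof -
  obtain \<S> where \<S>': "finite \<S> \<and> (\<forall>s\<in>\<S>. \<exists>a b. s = closed_segment a b) \<and> frontier \<Omega> = \<Union>\<S>"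
    using assms(1) unfolding polygonal_def ..
  then have \<S>: "finite \<S>" "frontier \<Omega> = \<Union>\<S>" by simp_all
  obtain a b where ab: "\<And>s. s \<in> \<S> \<Longrightarrow> s = closed_segment (a s) (b s)"
    using \<S>'[THEN conjunct2, THEN conjunct1, THEN bchoice] bchoice by metis
  obtain f where f: "\<S> = f ` {..<card \<S>}"
    using ex_bij_betw_nat_finite[OF \<S>(1)] by (metis atLeast0LessThan bij_betw_imp_surj_on)
  define m where "m = card \<S>"
  define L where "L = 1 + (\<Sum>s\<in>\<S>. dist (a s) (b s))"
  have L: "0 < L" "\<And>s. s \<in> \<S> \<Longrightarrow> dist (a s) (b s) \<le> L"
    using sum_nonneg[of \<S> "\<lambda>s. dist (a s) (b s)"] member_le_sum[of _ \<S> "\<lambda>s. dist (a s) (b s)"] \<S>(1)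
    by (auto simp: L_def intro!: add_increasing)
  have "hausdorff1 \<Gamma> \<le> ennreal (4 * m * L)"
    unfolding hausdorff1_def
  proof (rule SUP_least)
    fix \<delta> :: real assume "\<delta> \<in> {0<..}"
    obtain n :: nat where n: "2 * L / \<delta> < real n" using reals_Archimedean2 by blast
    have "0 < 2 * L / \<delta>" using L(1) \<open>\<delta> \<in> {0<..}\<close> by simp
    then have n_pos: "0 < n" using n by (metis gr0I less_asym of_nat_0)
    moreover have "2 * L < real n * \<delta>" using n \<open>\<delta> \<in> {0<..}\<close> by (simp add: pos_divide_less_eq)
    ultimately have n0: "0 < n" "2 * (L / n) \<le> \<delta>" by (simp_all add: pos_divide_le_eq mult.commute)
    have Ln: "0 \<le> L / n" using L(1) by simp
    \<comment> \<open>Each of the \<open>m\<close> segments is covered by \<open>n + 1\<close> balls of radius \<open>L / n\<close>.\<close>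
    define c where "c i = (let s = f (i div (n + 1)) in a s + (real (i mod (n + 1)) / n) *\<^sub>R (b s - a s))" for i
    define S where "S i = (if i < m * (n + 1) then cball (c i) (L / n) else {})" for i
    have diam: "diameter (S i) = (if i < m * (n + 1) then 2 * (L / n) else 0)" for i
      using Ln by (auto simp: S_def diameter_cball)
    have "\<Gamma> \<subseteq> (\<Union>i. S i)"
    proof
      fix x assume "x \<in> \<Gamma>"
      then obtain s where s: "s \<in> \<S>" "x \<in> s" using assms(2) \<S>(2) by blast
      then obtain j where j: "j < m" "s = f j" using f by (auto simp: m_def)
      obtain u where u01: "0 \<le> u" "u \<le> 1" and "x = (1 - u) *\<^sub>R a s + u *\<^sub>R b s"
        using s(2) ab[OF s(1)] in_segment(1) by metis
      then have u: "0 \<le> u" "u \<le> 1" "x = a s + u *\<^sub>R (b s - a s)" by (simp_all add: algebra_simps)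
      define t where "t = nat \<lfloor>u * n\<rfloor>"
      have t: "real t \<le> u * n" "u * n < real t + 1" using u(1) by (auto simp: t_def)
      have "u * real n \<le> 1 * real n" using u(2) by (intro mult_right_mono) simp_all
      then have "real t \<le> n" using t(1) by simp
      then have tn: "t \<le> n" by simp
      define i where "i = t + j * (n + 1)"
      have i: "i div (n + 1) = j" "i mod (n + 1) = t"
        unfolding i_def using tn by (subst div_mult_self1 mod_mult_self1; simp)+
      have "i < (j + 1) * (n + 1)" using tn by (simp add: i_def)
      also have "\<dots> \<le> m * (n + 1)" using j by (intro mult_le_mono1) simp
      finally have im: "i < m * (n + 1)" .
      have "u - real t / n = (u * n - real t) / n" using n0(1) by (simp add: diff_divide_distrib)
      moreover have "\<bar>u * n - real t\<bar> \<le> 1" using t by linarith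
      ultimately have "\<bar>u - real t / n\<bar> \<le> 1 / n" by (simp add: divide_right_mono)
      then have "\<bar>u - real t / n\<bar> * norm (b s - a s) \<le> 1 / n * L"
        using L(2)[OF s(1)] by (intro mult_mono) (auto simp: dist_norm norm_minus_commute)
      moreover have ci: "c i = a s + (real t / real n) *\<^sub>R (b s - a s)"
        unfolding c_def i Let_def j(2) ..
      have "x - c i = (u - real t / n) *\<^sub>R (b s - a s)"
        unfolding u(3) ci by (simp add: algebra_simps)
      ultimately have "x \<in> cball (c i) (L / n)" by (simp add: dist_norm norm_minus_commute)
      then show "x \<in> (\<Union>i. S i)" using im by (auto simp: S_def)
    qed
    moreover have "bounded (S i)" "diameter (S i) \<le> \<delta>" for i
      using n0 \<open>\<delta> \<in> {0<..}\<close> by (auto simp: diam) (auto simp: S_def)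
    ultimately have "(INF S\<in>{S. \<Gamma> \<subseteq> (\<Union>i. S i) \<and> (\<forall>i. bounded (S i) \<and> diameter (S i) \<le> \<delta>)}.
        \<Sum>i. ennreal (diameter (S i))) \<le> (\<Sum>i. ennreal (diameter (S i)))"
      by (intro INF_lower) auto
    also have "\<dots> = (\<Sum>i<m * (n + 1). ennreal (diameter (S i)))"
      by (rule suminf_finite) (auto simp: diam)
    also have "\<dots> = ennreal (\<Sum>i<m * (n + 1). diameter (S i))"
      by (rule sum_ennreal) (use L(1) in \<open>auto simp: diam\<close>)
    also have "(\<Sum>i<m * (n + 1). diameter (S i)) = real (m * (n + 1)) * (2 * (L / n))"
      by (simp add: diam)
    also have "\<dots> \<le> 4 * m * L"
    proof -
      have "real (n + 1) * (2 * (L / n)) \<le> 4 * L" using n0(1) L(1) by (simp add: field_simps)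
      then have "m * (real (n + 1) * (2 * (L / n))) \<le> m * (4 * L)" by (intro mult_left_mono) auto
      then show ?thesis by (simp add: algebra_simps)
    qed
    finally show "(INF S\<in>{S. \<Gamma> \<subseteq> (\<Union>i. S i) \<and> (\<forall>i. bounded (S i) \<and> diameter (S i) \<le> \<delta>)}.
        \<Sum>i. ennreal (diameter (S i))) \<le> ennreal (4 * m * L)"
      by (simp add: ennreal_leI)
  qed
  then have "hausdorff1 \<Gamma> < \<infinity>" using order_le_less_trans by fastforce
  then show ?thesis by (simp add: arc_measure_def emeasure_measure_of_conv)
qed

text \<open>
  For functions continuous up to the boundary the traces are the boundary values, which are bounded and
  measurable; finiteness of the arc length then makes all products integrable.
\<close>

lemma hermitian_form_boundary:
  assumes \<Omega>: "open \<Omega>" "bounded \<Omega>" and \<Gamma>: "\<Gamma> \<in> sets borel" "\<Gamma> \<subseteq> frontier \<Omega>" "emeasure arc_measure \<Gamma> < \<infinity>"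
    and S: "function_space S" "\<And>v. v \<in> S \<Longrightarrow> continuous_on (closure \<Omega>) v" and P: "Omega P = \<Omega>"
  shows "hermitian_form S (boundary_inner P \<Gamma>)"
proof -
  have sets: "sets arc_measure = sets borel"
    by (simp add: arc_measure_def sets_measure_of_conv sets.sigma_sets_eq[of borel, simplified])
  have sub: "\<Gamma> \<subseteq> closure \<Omega>" using \<Gamma>(2) by (auto simp: frontier_def)
  have "hermitian_form S (\<lambda>v w. LINT x:\<Gamma>|arc_measure. v x * cnj (w x))"
  proof (rule hermitian_form_integral[OF S(1)])
    fix v w assume vw: "v \<in> S" "w \<in> S"
    obtain K where K: "\<And>x. x \<in> closure \<Omega> \<Longrightarrow> cmod (v x) \<le> K"
      using continuous_on_closure_bounded[OF \<Omega>(2) S(2)[OF vw(1)]] by blast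
    obtain K' where K': "\<And>x. x \<in> closure \<Omega> \<Longrightarrow> cmod (w x) \<le> K'"
      using continuous_on_closure_bounded[OF \<Omega>(2) S(2)[OF vw(2)]] by blast
    show "set_integrable arc_measure \<Gamma> (\<lambda>x. v x * cnj (w x))"
    proof (rule bounded_set_integrable)
      have "continuous_on \<Gamma> (\<lambda>x. v x * cnj (w x))"
        using S(2)[OF vw(1)] S(2)[OF vw(2)] sub by (intro continuous_intros) (auto intro: continuous_on_subset)
      then show "set_borel_measurable arc_measure \<Gamma> (\<lambda>x. v x * cnj (w x))"
        unfolding set_borel_measurable_def
        using borel_measurable_continuous_on_indicator[OF \<Gamma>(1)] measurable_cong_sets[OF sets refl] by blast
      show "cmod (v x * cnj (w x)) \<le> K * K'" if "x \<in> \<Gamma>" for x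
        using K[of x] K'[of x] that sub by (auto simp: norm_mult intro!: mult_mono intro: order_trans[OF norm_ge_zero])
    qed (use \<Gamma> sets in simp_all)
  qed
  then show ?thesis
  proof (rule hermitian_form_cong)
    fix v w assume vw: "v \<in> S" "w \<in> S"
    show "boundary_inner P \<Gamma> v w = (LINT x:\<Gamma>|arc_measure. v x * cnj (w x))"
      unfolding boundary_inner_def P
      using boundary_trace_continuous[OF \<Omega> S(2)] vw sub \<Gamma>(1) sets
      by (intro set_lebesgue_integral_cong) (auto simp: subset_eq)
  qed
qed

section \<open>Affine functions and triangles\<close>

lemma affine_fun_iff_linear: "affine_fun p \<longleftrightarrow> (\<exists>c g. linear g \<and> p = (\<lambda>x. c + g x))"
proof
  assume "affine_fun p"
  then obtain c d1 d2 where p: "p = (\<lambda>x. c + (d1 * of_real (x $ 1) + d2 * of_real (x $ 2)))"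
    unfolding affine_fun_def by (auto simp: fun_eq_iff add.assoc)
  have "linear (\<lambda>x::point. d1 * of_real (x $ 1) + d2 * complex_of_real (x $ 2))"
    by (rule linearI) (simp_all add: algebra_simps scaleR_conv_of_real[where 'a = complex])
  then show "\<exists>c g. linear g \<and> p = (\<lambda>x. c + g x)" using p by blast
next
  assume "\<exists>c g. linear g \<and> p = (\<lambda>x. c + g x)"
  then obtain c g where g: "linear g" and p: "p = (\<lambda>x. c + g x)" by blast
  have "g x = g (axis 1 1) * of_real (x $ 1) + g (axis 2 1) * of_real (x $ 2)" for x
  proof -
    have "x = (x $ 1) *\<^sub>R axis 1 1 + (x $ 2) *\<^sub>R axis 2 1"
      by (simp add: vec_eq_iff forall_2 axis_def)
    then have "g x = g ((x $ 1) *\<^sub>R axis 1 1 + (x $ 2) *\<^sub>R axis 2 1)" by (rule arg_cong)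
    also have "\<dots> = (x $ 1) *\<^sub>R g (axis 1 1) + (x $ 2) *\<^sub>R g (axis 2 1)"
      by (simp only: linear_add[OF g] linear_scale[OF g])
    finally show ?thesis by (simp add: scaleR_conv_of_real mult.commute)
  qed
  then have "\<forall>x. c + g x = c + g (axis 1 1) * of_real (x $ 1) + g (axis 2 1) * of_real (x $ 2)"
    by (metis add.assoc)
  then show "affine_fun p" unfolding affine_fun_def p by blast
qed

lemma affine_fun_add: "affine_fun p \<Longrightarrow> affine_fun q \<Longrightarrow> affine_fun (\<lambda>x. p x + q x)"
proof -
  assume "affine_fun p" "affine_fun q"
  then obtain c d g h where "linear g" "linear h" "p = (\<lambda>x. c + g x)" "q = (\<lambda>x. d + h x)"
    unfolding affine_fun_iff_linear by blast
  then have "linear (\<lambda>x. g x + h x)" "(\<lambda>x. p x + q x) = (\<lambda>x. (c + d) + (g x + h x))"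
    by (auto intro: linear_compose_add simp: fun_eq_iff)
  then show ?thesis unfolding affine_fun_iff_linear by blast
qed

lemma affine_fun_scale: "affine_fun p \<Longrightarrow> affine_fun (\<lambda>x. a * p x)"
  unfolding affine_fun_def
proof (elim exE)
  fix c d1 d2 assume "\<forall>x. p x = c + d1 * of_real (x $ 1) + d2 * of_real (x $ 2)"
  then have eq: "\<forall>x. a * p x = a * c + (a * d1) * of_real (x $ 1) + (a * d2) * of_real (x $ 2)"
    by (simp add: algebra_simps)
  show "\<exists>c d1 d2. \<forall>x. a * p x = c + d1 * of_real (x $ 1) + d2 * of_real (x $ 2)"
    by (rule exI[of _ "a * c"], rule exI[of _ "a * d1"], rule exI[of _ "a * d2"], rule eq)
qed

lemma affine_fun_const: "affine_fun (\<lambda>_. c)"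
  unfolding affine_fun_def by (rule exI[of _ c], rule exI[of _ 0], rule exI[of _ 0]) simp

lemma affine_fun_continuous: "affine_fun p \<Longrightarrow> continuous_on A p"
proof -
  assume "affine_fun p"
  then obtain c d1 d2 where "p = (\<lambda>x. c + d1 * of_real (x $ 1) + d2 * of_real (x $ 2))"
    unfolding affine_fun_def by blast
  then show ?thesis by (auto intro!: continuous_intros)
qed

text \<open>
  The zero set of an affine function is convex.
\<close>

lemma affine_fun_zero_hull:
  assumes "affine_fun p" "\<And>x. x \<in> A \<Longrightarrow> p x = 0" "x \<in> convex hull A"
  shows "p x = 0"
proof -
  obtain c g where g: "linear g" "p = (\<lambda>x. c + g x)"
    using assms(1) unfolding affine_fun_iff_linear by blast
  have "convex {x. p x = 0}"
  proof (rule convexI)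
    fix x y and u v :: real assume "x \<in> {x. p x = 0}" "y \<in> {x. p x = 0}" and uv: "u + v = 1"
    then have "g x = - c" "g y = - c" using g(2) by (auto simp: add_eq_0_iff)
    then have "g (u *\<^sub>R x + v *\<^sub>R y) = (u + v) *\<^sub>R (- c)"
      by (simp only: linear_add[OF g(1)] linear_scale[OF g(1)] scaleR_add_left)
    then show "u *\<^sub>R x + v *\<^sub>R y \<in> {x. p x = 0}" using uv g(2) by simp
  qed
  then have "convex hull A \<subseteq> {x. p x = 0}" using assms(2) by (intro hull_minimal) auto
  then show ?thesis using assms(3) by blast
qed

lemma affine_fun_zero_open:
  assumes "affine_fun p" "open U" "U \<noteq> {}" "\<And>x. x \<in> U \<Longrightarrow> p x = 0"
  shows "p = (\<lambda>_. 0)"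
proof
  fix y
  obtain c g where g: "linear g" "p = (\<lambda>x. c + g x)"
    using assms(1) unfolding affine_fun_iff_linear by blast
  obtain t where t: "t \<in> U" using assms(3) by blast
  then obtain e where e: "0 < e" "cball t e \<subseteq> U" using assms(2) open_contains_cball by blast
  define s where "s = e / (norm (y - t) + 1)"
  have "norm (y - t) + 1 > 0" using norm_ge_zero[of "y - t"] by linarith
  then have s: "s > 0" "s * norm (y - t) \<le> e" using e(1) by (simp_all add: s_def field_simps)
  then have "t + s *\<^sub>R (y - t) \<in> cball t e" by (simp add: dist_norm)
  then have "c + (g t + s *\<^sub>R (g y - g t)) = 0" "c + g t = 0"
    using assms(4)[of "t + s *\<^sub>R (y - t)"] assms(4)[OF t] e(2) g
    by (auto simp: linear_add linear_scale linear_diff)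
  then have "s *\<^sub>R (g y - g t) = 0" by (simp add: add.assoc[symmetric])
  then have "g y = g t" using s(1) by simp
  then show "p y = 0" using g(2) \<open>c + g t = 0\<close> by simp
qed

lemma open_triangleE:
  assumes "open_triangle T"
  obtains a b c where "\<not> affine_dependent {a, b, c}" "card {a, b, c} = 3" "closure T = convex hull {a, b, c}"
    "vertices T = {a, b, c}"
proof -
  obtain a b c where nc: "\<not> collinear {a, b, c}" and T: "T = interior (convex hull {a, b, c})"
    using assms unfolding open_triangle_def by blast
  have ind: "\<not> affine_dependent {a, b, c}" using nc affine_dependent_imp_collinear_3 by blast
  have "a \<noteq> b" "a \<noteq> c" "b \<noteq> c" using nc by (auto simp: insert_commute)
  then have card: "card {a, b, c} = 3" by simp
  have "interior (convex hull {a, b, c}) \<noteq> {}"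
    using interior_convex_hull_eq_empty[of "{a, b, c}"] card ind by simp
  then have cl: "closure T = convex hull {a, b, c}"
    unfolding T by (simp add: convex_closure_interior closure_closed compact_imp_closed finite_imp_compact_convex_hull)
  have "vertices T = {a, b, c}"
    unfolding vertices_def cl using extreme_point_of_convex_hull_affine_independent[OF ind] by auto
  then show ?thesis using that ind card cl by blast
qed

lemma open_triangle_geometry:
  assumes "open_triangle T"
  shows "open T" "T \<noteq> {}" "bounded T" "convex (closure T)" "compact (closure T)"
    "closure T = convex hull vertices T" "finite (vertices T)" "vertices T \<subseteq> closure T" "convex T"
proof -
  obtain a b c where abc: "closure T = convex hull {a, b, c}" "vertices T = {a, b, c}"
    using open_triangleE[OF assms] by metis
  then show "closure T = convex hull vertices T" "finite (vertices T)" "convex (closure T)" "compact (closure T)"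
    by (simp_all add: finite_imp_compact_convex_hull)
  then show "vertices T \<subseteq> closure T" by (simp add: hull_subset)
  show "bounded T" by (rule bounded_subset[OF compact_imp_bounded[OF \<open>compact (closure T)\<close>] closure_subset])
  show "open T" "convex T" using assms by (auto simp: open_triangle_def convex_interior)
  have "closure T \<noteq> {}" using abc by simp
  then show "T \<noteq> {}" by auto
qed

text \<open>
  The two edge vectors at one vertex are linearly independent, so the linear part can be prescribed on them.
\<close>

lemma affine_interpolation:
  assumes "open_triangle T"
  shows "\<exists>p. affine_fun p \<and> (\<forall>z\<in>vertices T. p z = f z)"
proof -
  obtain a b c where ind: "\<not> affine_dependent {a, b, c}" and card: "card {a, b, c} = 3"
    and v: "vertices T = {a, b, c}" using open_triangleE[OF assms] by metis
  have a: "a \<notin> {b, c}" using card by (auto simp: card_insert_if split: if_splits)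
  have "independent ((\<lambda>x. x - a) ` {b, c})"
    using ind affine_dependent_iff_dependent[OF a] by (simp add: setcompr_eq_image)
  from linear_independent_extend[OF this, of "\<lambda>y. f (y + a) - f a"]
  obtain g where g: "linear g" "\<And>x. x \<in> {b, c} \<Longrightarrow> g (x - a) = f x - f a" by auto
  have "f a - g a + g z = f z" if "z \<in> vertices T" for z
    using that g(2)[of z] linear_diff[OF g(1), of z a] v by (auto simp: algebra_simps)
  then show ?thesis unfolding affine_fun_iff_linear using g(1)
    by (intro exI[of _ "\<lambda>x. (f a - g a) + g x"]) blast
qed

section \<open>Continuous piecewise affine functions\<close>

lemma mesh_triangle: "conforming_mesh \<Omega> \<T> \<Longrightarrow> T \<in> \<T> \<Longrightarrow> open_triangle T"
  by (simp add: conforming_mesh_def)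

lemma mesh_subset: "conforming_mesh \<Omega> \<T> \<Longrightarrow> T \<in> \<T> \<Longrightarrow> closure T \<subseteq> closure \<Omega>"
  by (intro closure_mono) (simp add: conforming_mesh_def)

lemma finite_nodes: "conforming_mesh \<Omega> \<T> \<Longrightarrow> finite (nodes \<T>)"
  unfolding nodes_def by (intro finite_UN_I) (auto simp: conforming_mesh_def intro: open_triangle_geometry(7))

lemma P1_affine: "u \<in> P1 \<Omega> \<T> \<Longrightarrow> T \<in> \<T> \<Longrightarrow> \<exists>p. affine_fun p \<and> (\<forall>x\<in>T. u x = p x)"
  by (simp add: P1_def)

lemma function_space_P1: "function_space (P1 \<Omega> \<T>)"
proof
  have "\<exists>p. affine_fun p \<and> (\<forall>x\<in>T. 0 = p x)" for T
    by (rule exI[of _ "\<lambda>_. 0"]) (simp add: affine_fun_const)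
  then show "(\<lambda>_. 0) \<in> P1 \<Omega> \<T>" by (simp add: P1_def)
  show "(\<lambda>x. v x + w x) \<in> P1 \<Omega> \<T>" if "v \<in> P1 \<Omega> \<T>" "w \<in> P1 \<Omega> \<T>" for v w
  proof -
    have "\<exists>p. affine_fun p \<and> (\<forall>x\<in>T. v x + w x = p x)" if T: "T \<in> \<T>" for T
    proof -
      obtain p q where "affine_fun p" "affine_fun q" "\<forall>x\<in>T. v x = p x" "\<forall>x\<in>T. w x = q x"
        using P1_affine[OF \<open>v \<in> P1 \<Omega> \<T>\<close> T] P1_affine[OF \<open>w \<in> P1 \<Omega> \<T>\<close> T] by metis
      then show ?thesis by (intro exI[of _ "\<lambda>x. p x + q x"]) (simp add: affine_fun_add)
    qed
    then show ?thesis using that by (simp add: P1_def continuous_on_add)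
  qed
  show "(\<lambda>x. c * v x) \<in> P1 \<Omega> \<T>" if "v \<in> P1 \<Omega> \<T>" for v c
  proof -
    have "\<exists>p. affine_fun p \<and> (\<forall>x\<in>T. c * v x = p x)" if T: "T \<in> \<T>" for T
    proof -
      obtain p where "affine_fun p" "\<forall>x\<in>T. v x = p x"
        using P1_affine[OF \<open>v \<in> P1 \<Omega> \<T>\<close> T] by metis
      then show ?thesis by (intro exI[of _ "\<lambda>x. c * p x"]) (simp add: affine_fun_scale)
    qed
    then show ?thesis using that by (simp add: P1_def continuous_on_mult_left)
  qed
qed

lemma P1_affine_on_closure:
  assumes mesh: "conforming_mesh \<Omega> \<T>" and T: "T \<in> \<T>" and u: "u \<in> P1 \<Omega> \<T>"
  obtains p where "affine_fun p" "\<And>x. x \<in> closure T \<Longrightarrow> u x = p x"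
proof -
  obtain p where p: "affine_fun p" "\<And>x. x \<in> T \<Longrightarrow> u x = p x" using P1_affine[OF u T] by metis
  have "continuous_on (closure T) (\<lambda>x. u x - p x)"
    using u mesh_subset[OF mesh T] affine_fun_continuous[OF p(1)] unfolding P1_def
    by (auto intro!: continuous_on_diff elim: continuous_on_subset)
  then have "u x - p x = 0" if "x \<in> closure T" for x
    using continuous_constant_on_closure[of T "\<lambda>x. u x - p x" 0] p(2) that by simp
  then have "u x = p x" if "x \<in> closure T" for x using that by simp
  then show ?thesis by (rule that[OF p(1)])
qed

text \<open>
  On each element the function is affine up to the boundary and vanishes at the vertices. This is what
  makes the fine nodes a determining set for the discrete spaces.
\<close>

lemma P1_zero_at_nodes_imp_zero:
  assumes mesh: "conforming_mesh \<Omega> \<T>" and u: "u \<in> P1 \<Omega> \<T>" and zero: "\<forall>z\<in>nodes \<T>. u z = 0"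
  shows "u = (\<lambda>_. 0)"
proof
  fix x
  show "u x = 0"
  proof (cases "x \<in> closure \<Omega>")
    case True
    moreover have "(\<Union>T\<in>\<T>. closure T) = closure \<Omega>" using mesh by (simp add: conforming_mesh_def)
    ultimately obtain T where T: "T \<in> \<T>" "x \<in> closure T" by blast
    obtain p where p: "affine_fun p" "\<And>x. x \<in> closure T \<Longrightarrow> u x = p x"
      using P1_affine_on_closure[OF mesh T(1) u] by blast
    note tri = open_triangle_geometry[OF mesh_triangle[OF mesh T(1)]]
    have "p z = 0" if "z \<in> vertices T" for z
      using that p(2)[of z] tri(8) zero T(1) by (auto simp: nodes_def)
    then have "p x = 0" using affine_fun_zero_hull[OF p(1)] T(2) tri(6) by blast
    then show ?thesis using p(2) T(2) by simp
  next
    case False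
    then show ?thesis using u unfolding P1_def by blast
  qed
qed

text \<open>
  The common part of two closed elements is a face of both. By the Krein--Milman theorem it is the convex
  hull of its extreme points, which are vertices of both elements.
\<close>

lemma conforming_interpolants_agree:
  assumes mesh: "conforming_mesh \<Omega> \<T>" and S: "S \<in> \<T>" and T: "T \<in> \<T>"
    and p: "affine_fun p" "\<And>z. z \<in> vertices S \<Longrightarrow> p z = f z"
    and q: "affine_fun q" "\<And>z. z \<in> vertices T \<Longrightarrow> q z = f z"
    and x: "x \<in> closure S" "x \<in> closure T"
  shows "p x = q x"
proof -
  define K where "K = closure S \<inter> closure T"
  have face: "K face_of closure S" "K face_of closure T"
    using mesh S T by (auto simp: conforming_mesh_def K_def)
  have "compact K" "convex K"
    unfolding K_def using open_triangle_geometry(4,5)[OF mesh_triangle[OF mesh S]] open_triangle_geometry(4,5)[OF mesh_triangle[OF mesh T]]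
    by (simp_all add: convex_Int compact_Int)
  then have hull: "K = convex hull {z. z extreme_point_of K}" by (rule Krein_Milman_Minkowski)
  have d: "affine_fun (\<lambda>x. p x + (-1) * q x)" by (intro affine_fun_add affine_fun_scale p q)
  have "p z + (-1) * q z = 0" if "z \<in> {z. z extreme_point_of K}" for z
    using that extreme_point_of_face[OF face(1), of z] extreme_point_of_face[OF face(2), of z] p(2)[of z] q(2)[of z]
    by (simp add: vertices_def)
  moreover have "x \<in> convex hull {z. z extreme_point_of K}"
    unfolding hull[symmetric] using x by (simp add: K_def)
  ultimately have "p x + (-1) * q x = 0" by (rule affine_fun_zero_hull[OF d])
  then show ?thesis by simp
qed

text \<open>
  The affine interpolants on the elements agree on common parts, so they glue to a continuous function.
\<close>

lemma nodal_interpolant_exists: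
  assumes mesh: "conforming_mesh \<Omega> \<T>"
  shows "\<exists>u. u \<in> P1 \<Omega> \<T> \<and> (\<forall>z\<in>nodes \<T>. u z = f z)"
proof -
  have "\<forall>T\<in>\<T>. \<exists>p. affine_fun p \<and> (\<forall>z\<in>vertices T. p z = f z)"
    using affine_interpolation mesh_triangle[OF mesh] by blast
  then obtain p where p: "\<And>T. T \<in> \<T> \<Longrightarrow> affine_fun (p T)" "\<And>T z. T \<in> \<T> \<Longrightarrow> z \<in> vertices T \<Longrightarrow> p T z = f z"
    by metis
  have cover: "(\<Union>T\<in>\<T>. closure T) = closure \<Omega>" and fin: "finite \<T>"
    using mesh by (simp_all add: conforming_mesh_def)
  define u where "u x = (if x \<in> closure \<Omega> then p (SOME T. T \<in> \<T> \<and> x \<in> closure T) x else 0)" for x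
  have u: "u x = p T x" if "T \<in> \<T>" "x \<in> closure T" for T x
  proof -
    let ?S = "SOME S. S \<in> \<T> \<and> x \<in> closure S"
    have S: "?S \<in> \<T> \<and> x \<in> closure ?S" by (rule someI[of _ T]) (use that in simp)
    have "p ?S x = p T x"
      by (rule conforming_interpolants_agree[OF mesh, of ?S T _ f]) (use S that p in auto)
    moreover have "x \<in> closure \<Omega>" using that cover by blast
    ultimately show ?thesis by (simp add: u_def)
  qed
  have "u \<in> P1 \<Omega> \<T>"
    unfolding P1_def
  proof (intro CollectI conjI ballI)
    have "continuous_on (\<Union>T\<in>\<T>. closure T) u"
    proof (rule continuous_on_closed_Union[OF fin])
      show "continuous_on (closure T) u" if "T \<in> \<T>" for T
        using affine_fun_continuous[OF p(1)[OF that]] u[OF that] by (simp cong: continuous_on_cong)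
    qed simp
    then show "continuous_on (closure \<Omega>) u" by (simp add: cover)
    show "\<exists>q. affine_fun q \<and> (\<forall>x\<in>T. u x = q x)" if "T \<in> \<T>" for T
      using p(1)[OF that] u[OF that] closure_subset[of T] by blast
  qed (simp add: u_def)
  moreover have "u z = f z" if z: "z \<in> nodes \<T>" for z
  proof -
    obtain T where T: "T \<in> \<T>" "z \<in> vertices T" using z by (auto simp: nodes_def)
    then show ?thesis using u[of T z] p(2) open_triangle_geometry(8)[OF mesh_triangle[OF mesh T(1)]] by auto
  qed
  ultimately show ?thesis by blast
qed

text \<open>
  The interpolant is given by a definite description. The forward direction therefore rests on the
  existence of an interpolant: otherwise the description could denote zero for nonzero data.
\<close>

lemma nodal_interpolant_zero_iff:
  assumes mesh: "conforming_mesh \<Omega> \<T>"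
  shows "nodal_interpolant \<Omega> \<T> f = (\<lambda>_. 0) \<longleftrightarrow> (\<forall>z\<in>nodes \<T>. f z = 0)"
proof -
  interpret function_space "P1 \<Omega> \<T>" by (rule function_space_P1)
  have "\<exists>!u. u \<in> P1 \<Omega> \<T> \<and> (\<forall>z\<in>nodes \<T>. u z = f z)"
  proof (rule ex_ex1I[OF nodal_interpolant_exists[OF mesh]])
    fix u v assume "u \<in> P1 \<Omega> \<T> \<and> (\<forall>z\<in>nodes \<T>. u z = f z)" "v \<in> P1 \<Omega> \<T> \<and> (\<forall>z\<in>nodes \<T>. v z = f z)"
    then have "(\<lambda>x. u x - v x) = (\<lambda>_. 0)"
      by (intro P1_zero_at_nodes_imp_zero[OF mesh] diff_mem) auto
    then show "u = v" by (simp add: fun_eq_iff)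
  qed
  then have spec: "nodal_interpolant \<Omega> \<T> f \<in> P1 \<Omega> \<T>" "\<forall>z\<in>nodes \<T>. nodal_interpolant \<Omega> \<T> f z = f z"
    using theI'[of "\<lambda>u. u \<in> P1 \<Omega> \<T> \<and> (\<forall>z\<in>nodes \<T>. u z = f z)"] unfolding nodal_interpolant_def by blast+
  then show ?thesis using P1_zero_at_nodes_imp_zero[OF mesh spec(1)] by auto
qed

section \<open>The elementwise projection\<close>

lemma function_space_affine: "function_space {p. affine_fun p}"
  by unfold_locales (auto intro: affine_fun_const affine_fun_add affine_fun_scale)

lemma affine_square_integrable:
  assumes "open_triangle T" "affine_fun p"
  shows "square_integrable_on p T"
  using open_triangle_geometry[OF assms(1)]
  by (intro continuous_imp_square_integrable[where \<Omega> = T] affine_fun_continuous assms(2)) simp_all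

text \<open>
  The projection is the Riesz representer of \<open>L2_inner T v\<close> among affine functions, a space determined by
  the three vertex values.
\<close>

lemma L2_proj_iff:
  assumes T: "open_triangle T" and v: "square_integrable_on v T"
  shows "L2_proj T v = p \<longleftrightarrow> affine_fun p \<and> (\<forall>q. affine_fun q \<longrightarrow> L2_inner T v q = L2_inner T p q)"
proof -
  note tri = open_triangle_geometry[OF T] and sq = affine_square_integrable[OF T]
  interpret L2: hermitian_form "{v :: cfun. square_integrable_on v T}" "L2_inner T"
    by (rule hermitian_form_L2[OF function_space_square_integrable]) simp
  have sub: "{p. affine_fun p} \<subseteq> {v. square_integrable_on v T}"
    using sq by (rule Collect_mono[OF impI])
  interpret Aff: hermitian_form "{p. affine_fun p}" "L2_inner T"
    by (rule L2.hermitian_form_subspace[OF function_space_affine sub])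
  have definite: "p = (\<lambda>_. 0)" if "p \<in> {p. affine_fun p}" "L2_inner T p p = 0" for p
  proof -
    have p: "affine_fun p" using that(1) by simp
    have ae: "AE x in lebesgue. x \<in> T \<longrightarrow> p x = 0" by (rule square_integral_zero_imp_AE[OF sq[OF p] that(2)])
    show ?thesis
      by (rule affine_fun_zero_open[OF p tri(1,2)])
        (rule AE_zero_imp_zero[OF tri(1) affine_fun_continuous[OF p] ae])
  qed
  have determining: "p = (\<lambda>_. 0)" if "p \<in> {p. affine_fun p}" "\<forall>z\<in>vertices T. p z = 0" for p
  proof -
    have p: "affine_fun p" using that(1) by simp
    show ?thesis
    proof (rule affine_fun_zero_open[OF p tri(1,2)])
      fix x assume "x \<in> T"
      then have x: "x \<in> convex hull vertices T" unfolding tri(6)[symmetric] using closure_subset by blast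
      show "p x = 0" by (rule affine_fun_zero_hull[OF p _ x]) (use that(2) in simp)
    qed
  qed
  have "antilinear_on {v. square_integrable_on v T} (L2_inner T v)"
    by (rule L2.form_antilinear) (simp add: v)
  then have anti: "antilinear_on {p. affine_fun p} (L2_inner T v)" using sub by (rule antilinear_on_subset)
  have "\<exists>r\<in>{p. affine_fun p}. \<forall>q\<in>{p. affine_fun p}. L2_inner T r q = L2_inner T v q"
    by (rule finite_dimensional_Riesz[OF tri(7) Aff.hermitian_form_axioms _ _ anti])
      (erule (1) determining, erule (1) definite)
  then obtain r where r: "affine_fun r" "\<And>q. affine_fun q \<Longrightarrow> L2_inner T r q = L2_inner T v q"
    unfolding Bex_def Ball_def mem_Collect_eq by metis
  have unique: "p = r" if "affine_fun p" "\<And>q. affine_fun q \<Longrightarrow> L2_inner T p q = L2_inner T v q" for p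
  proof (rule Aff.form_representer_unique)
    show "\<And>v. v \<in> {p. affine_fun p} \<Longrightarrow> L2_inner T v v = 0 \<Longrightarrow> v = (\<lambda>_. 0)"
      by (erule (1) definite)
    show "L2_inner T p w = L2_inner T r w" if "w \<in> {p. affine_fun p}" for w
      using that r(2) \<open>\<And>q. affine_fun q \<Longrightarrow> L2_inner T p q = L2_inner T v q\<close> by simp
  qed (use that(1) r(1) in simp_all)
  have eq: "(LINT x:T|lebesgue. (v x - p x) * cnj (q x)) = L2_inner T v q - L2_inner T p q"
    if "affine_fun p" "affine_fun q" for p q
    unfolding L2_inner_def left_diff_distrib
    using that by (intro set_integral_diff(2) square_integrable_mult_cnj v sq)
  have "L2_proj T v = r"
    unfolding L2_proj_def
  proof (rule the_equality)
    show "affine_fun r \<and> (\<forall>q. affine_fun q \<longrightarrow> (LINT x:T|lebesgue. (v x - r x) * cnj (q x)) = 0)"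
      using r eq by simp
    fix p assume "affine_fun p \<and> (\<forall>q. affine_fun q \<longrightarrow> (LINT x:T|lebesgue. (v x - p x) * cnj (q x)) = 0)"
    then show "p = r" using eq[of p] by (intro unique) auto
  qed
  then show ?thesis using r unique[of p] by metis
qed

lemma L2_proj_linear:
  assumes T: "open_triangle T" and v: "square_integrable_on v T"
  shows "square_integrable_on w T \<Longrightarrow> L2_proj T (\<lambda>x. v x + w x) = (\<lambda>x. L2_proj T v x + L2_proj T w x)"
    and "L2_proj T (\<lambda>x. c * v x) = (\<lambda>x. c * L2_proj T v x)"
proof -
  interpret L2: hermitian_form "{v :: cfun. square_integrable_on v T}" "L2_inner T"
    by (rule hermitian_form_L2[OF function_space_square_integrable]) simp
  note tri = open_triangle_geometry[OF T]
  note sub = affine_square_integrable[OF T]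
  have pv: "affine_fun (L2_proj T v)" "\<And>q. affine_fun q \<Longrightarrow> L2_inner T v q = L2_inner T (L2_proj T v) q"
    using L2_proj_iff[OF T v] by blast+
  have cv: "square_integrable_on (\<lambda>x. c * v x) T" using L2.scale_mem v by simp
  show "L2_proj T (\<lambda>x. c * v x) = (\<lambda>x. c * L2_proj T v x)"
    unfolding L2_proj_iff[OF T cv] using pv v sub by (simp add: affine_fun_scale L2.form_scale)
  assume w: "square_integrable_on w T"
  have pw: "affine_fun (L2_proj T w)" "\<And>q. affine_fun q \<Longrightarrow> L2_inner T w q = L2_inner T (L2_proj T w) q"
    using L2_proj_iff[OF T w] by blast+
  have vw: "square_integrable_on (\<lambda>x. v x + w x) T" using L2.add_mem v w by simp
  show "L2_proj T (\<lambda>x. v x + w x) = (\<lambda>x. L2_proj T v x + L2_proj T w x)"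
    unfolding L2_proj_iff[OF T vw] using pv pw v w sub by (simp add: affine_fun_add L2.form_add)
qed

text \<open>
  Whether \<open>I_H P v\<close> vanishes is decided by the vertex averages of the elementwise projections, and these
  are linear in \<open>v\<close>.
\<close>

lemma function_space_kernel_I_H:
  assumes mesh: "conforming_mesh (Omega P) (coarse_mesh P)" and S: "function_space S"
    and sq: "\<And>v T. v \<in> S \<Longrightarrow> T \<in> coarse_mesh P \<Longrightarrow> square_integrable_on v T"
  shows "function_space {v\<in>S. I_H P v = (\<lambda>_. 0)}"
proof -
  interpret function_space S by fact
  define N where "N v z = (if z \<in> closure (Gamma_D P) then 0
          else (\<Sum>T | T \<in> coarse_mesh P \<and> z \<in> closure T. L2_proj T v z * of_real (measure lebesgue T)) /
               of_real (\<Sum>T | T \<in> coarse_mesh P \<and> z \<in> closure T. measure lebesgue T))" for v z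
  have I: "I_H P v = (\<lambda>_. 0) \<longleftrightarrow> (\<forall>z\<in>nodes (coarse_mesh P). N v z = 0)" for v
    unfolding I_H_def E_H_def nodal_interpolant_zero_iff[OF mesh] N_def ..
  have tri: "open_triangle T" if "T \<in> coarse_mesh P" for T using mesh_triangle[OF mesh that] .
  have Nadd: "N (\<lambda>x. v x + w x) z = N v z + N w z" if "v \<in> S" "w \<in> S" for v w z
  proof -
    have "L2_proj T (\<lambda>x. v x + w x) z = L2_proj T v z + L2_proj T w z" if "T \<in> coarse_mesh P" for T
      using L2_proj_linear(1)[OF tri[OF that] sq sq] \<open>v \<in> S\<close> \<open>w \<in> S\<close> that by simp
    then have "(\<Sum>T | T \<in> coarse_mesh P \<and> z \<in> closure T. L2_proj T (\<lambda>x. v x + w x) z * of_real (measure lebesgue T)) =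
        (\<Sum>T | T \<in> coarse_mesh P \<and> z \<in> closure T. L2_proj T v z * of_real (measure lebesgue T)) +
        (\<Sum>T | T \<in> coarse_mesh P \<and> z \<in> closure T. L2_proj T w z * of_real (measure lebesgue T))"
      unfolding sum.distrib[symmetric] by (intro sum.cong) (auto simp: distrib_right)
    then show ?thesis unfolding N_def by (simp only: add_divide_distrib) simp
  qed
  have Nscale: "N (\<lambda>x. c * v x) z = c * N v z" if "v \<in> S" for v c z
  proof -
    have "L2_proj T (\<lambda>x. c * v x) z = c * L2_proj T v z" if "T \<in> coarse_mesh P" for T
      using L2_proj_linear(2)[OF tri[OF that] sq] \<open>v \<in> S\<close> that by simp
    then have "(\<Sum>T | T \<in> coarse_mesh P \<and> z \<in> closure T. L2_proj T (\<lambda>x. c * v x) z * of_real (measure lebesgue T)) =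
        c * (\<Sum>T | T \<in> coarse_mesh P \<and> z \<in> closure T. L2_proj T v z * of_real (measure lebesgue T))"
      unfolding sum_distrib_left by (intro sum.cong) (auto simp: mult.assoc)
    then show ?thesis by (simp add: N_def)
  qed
  show ?thesis
  proof
    show "(\<lambda>_. 0) \<in> {v \<in> S. I_H P v = (\<lambda>_. 0)}"
      using zero_mem Nscale[OF zero_mem, of 0] by (simp add: I)
    show "(\<lambda>x. v x + w x) \<in> {v \<in> S. I_H P v = (\<lambda>_. 0)}"
      if "v \<in> {v \<in> S. I_H P v = (\<lambda>_. 0)}" "w \<in> {v \<in> S. I_H P v = (\<lambda>_. 0)}" for v w
      using that add_mem by (simp add: I Nadd)
    show "(\<lambda>x. c * v x) \<in> {v \<in> S. I_H P v = (\<lambda>_. 0)}" if "v \<in> {v \<in> S. I_H P v = (\<lambda>_. 0)}" for v c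
      using that scale_mem by (simp add: I Nscale)
  qed
qed

section \<open>The discrete Helmholtz problem\<close>

locale helmholtz =
  fixes P :: helmholtz_problem and k_min \<sigma>\<^sub>H \<sigma>\<^sub>h :: real
  assumes setting: "helmholtz_setting P k_min \<sigma>\<^sub>H \<sigma>\<^sub>h"
begin

lemma open_Omega: "open (Omega P)" and bounded_Omega: "bounded (Omega P)"
  and coarse_mesh: "conforming_mesh (Omega P) (coarse_mesh P)"
  and fine_mesh: "conforming_mesh (Omega P) (fine_mesh P)"
  and polygonal: "polygonal (Omega P)"
  and wavenumber_pos: "0 < wavenumber P"
  using setting by (auto simp: helmholtz_setting_def lipschitz_domain_def)

lemmas \<Omega> = open_Omega bounded_Omega

lemma Gamma_R: "Gamma_R P \<subseteq> frontier (Omega P)" "Gamma_R P \<in> sets borel"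
  and Gamma_D: "Gamma_D P \<subseteq> frontier (Omega P)"
proof -
  have o: "openin (top_of_set (frontier (Omega P))) (Gamma_R P)" "openin (top_of_set (frontier (Omega P))) (Gamma_D P)"
    using setting unfolding helmholtz_setting_def boundary_partition_def by blast+
  show "Gamma_R P \<subseteq> frontier (Omega P)" "Gamma_D P \<subseteq> frontier (Omega P)"
    using o[THEN openin_imp_subset] by auto
  obtain U where "open U" "Gamma_R P = frontier (Omega P) \<inter> U" using o(1) by (auto simp: openin_open)
  then show "Gamma_R P \<in> sets borel" using frontier_closed by simp
qed

lemma frontier_subset: "frontier (Omega P) \<subseteq> closure (Omega P)"
  by (simp add: frontier_def)

lemma V_hD:
  assumes "v \<in> V_h P"
  shows "v \<in> V P" "v \<in> H1 (Omega P)" "v \<in> P1 (Omega P) (fine_mesh P)" "continuous_on (closure (Omega P)) v"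
  using assms by (simp_all add: V_h_def V_def P1_def)

lemma trace_V_h: "v \<in> P1 (Omega P) (fine_mesh P) \<Longrightarrow> x \<in> closure (Omega P) \<Longrightarrow> boundary_trace (Omega P) v x = v x"
  by (intro boundary_trace_continuous \<Omega>) (simp_all add: P1_def)

text \<open>
  Traces of discrete functions are their boundary values, so the Dirichlet condition becomes a pointwise
  linear condition.
\<close>

lemma V_h_iff:
  "v \<in> V_h P \<longleftrightarrow> v \<in> P1 (Omega P) (fine_mesh P) \<and> v \<in> H1 (Omega P) \<and>
     (AE x in arc_measure. x \<in> Gamma_D P \<longrightarrow> v x = 0)"
proof -
  have "(x \<in> Gamma_D P \<longrightarrow> boundary_trace (Omega P) v x = 0) \<longleftrightarrow> (x \<in> Gamma_D P \<longrightarrow> v x = 0)"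
    if "v \<in> P1 (Omega P) (fine_mesh P)" for x
    using trace_V_h[OF that, of x] Gamma_D frontier_subset by auto
  then show ?thesis by (auto simp: V_h_def V_def)
qed

lemma function_space_V_h: "function_space (V_h P)"
proof -
  interpret H: function_space "H1 (Omega P)" by (rule function_space_H1[OF \<Omega>])
  interpret Q: function_space "P1 (Omega P) (fine_mesh P)" by (rule function_space_P1)
  show ?thesis
  proof
    show "(\<lambda>_. 0) \<in> V_h P" unfolding V_h_iff by (simp add: H.zero_mem Q.zero_mem)
    show "(\<lambda>x. v x + w x) \<in> V_h P" if "v \<in> V_h P" "w \<in> V_h P" for v w
    proof -
      have "AE x in arc_measure. x \<in> Gamma_D P \<longrightarrow> v x = 0" "AE x in arc_measure. x \<in> Gamma_D P \<longrightarrow> w x = 0"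
        using that unfolding V_h_iff by simp_all
      then have "AE x in arc_measure. x \<in> Gamma_D P \<longrightarrow> v x + w x = 0" by eventually_elim simp
      then show ?thesis using that unfolding V_h_iff by (simp add: H.add_mem Q.add_mem)
    qed
    show "(\<lambda>x. c * v x) \<in> V_h P" if "v \<in> V_h P" for v c
    proof -
      have "AE x in arc_measure. x \<in> Gamma_D P \<longrightarrow> v x = 0" using that unfolding V_h_iff by simp
      then have "AE x in arc_measure. x \<in> Gamma_D P \<longrightarrow> c * v x = 0" by eventually_elim simp
      then show ?thesis using that unfolding V_h_iff by (simp add: H.scale_mem Q.scale_mem)
    qed
  qed
qed

lemma coarse_element:
  assumes "T \<in> coarse_mesh P"
  shows "open T" "T \<subseteq> Omega P" "convex T"
  using coarse_mesh open_triangle_geometry[OF mesh_triangle[OF coarse_mesh assms]] assms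
  by (simp_all add: conforming_mesh_def)

lemma function_space_W_h: "function_space (W_h P)"
  unfolding W_h_def
proof (rule function_space_kernel_I_H[OF coarse_mesh function_space_V_h])
  show "square_integrable_on v T" if "v \<in> V_h P" "T \<in> coarse_mesh P" for v T
    using V_hD(4)[OF that(1)] coarse_element[OF that(2)]
    by (intro continuous_imp_square_integrable[OF bounded_Omega])
qed

lemma W_loc_subset: "W_loc P z \<subseteq> W_h P" "W_h P \<subseteq> V_h P" "W_loc P z \<subseteq> V_h P"
  by (auto simp: W_loc_def W_h_def)

lemma W_locD: "w \<in> W_loc P z \<Longrightarrow> x \<notin> closure (patch (coarse_mesh P) 2 {z}) \<Longrightarrow> w x = 0"
  using closure_subset[of "{x. w x \<noteq> 0}"] by (auto simp: W_loc_def)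

text \<open>
  The condition on the support says that \<open>w\<close> vanishes outside a fixed closed set.
\<close>

lemma function_space_W_loc: "function_space (W_loc P z)"
proof -
  interpret function_space "W_h P" by (rule function_space_W_h)
  let ?K = "closure (patch (coarse_mesh P) 2 {z})"
  have W: "w \<in> W_loc P z \<longleftrightarrow> w \<in> W_h P \<and> (\<forall>x. x \<notin> ?K \<longrightarrow> w x = 0)" for w
  proof
    assume "w \<in> W_h P \<and> (\<forall>x. x \<notin> ?K \<longrightarrow> w x = 0)"
    then have "w \<in> W_h P" "{x. w x \<noteq> 0} \<subseteq> ?K" by auto
    then show "w \<in> W_loc P z" by (simp add: W_loc_def closure_minimal)
  qed (use W_locD W_loc_subset in blast)
  show ?thesis
  proof
    show "(\<lambda>_. 0) \<in> W_loc P z" using zero_mem by (simp add: W)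
    show "(\<lambda>x. v x + w x) \<in> W_loc P z" if "v \<in> W_loc P z" "w \<in> W_loc P z" for v w
      using that add_mem by (simp add: W)
    show "(\<lambda>x. c * v x) \<in> W_loc P z" if "v \<in> W_loc P z" for v c
      using that scale_mem by (simp add: W)
  qed
qed

lemma Omega_lebesgue: "Omega P \<in> sets lebesgue"
  using bounded_open_lebesgue[OF \<Omega>] by simp

sublocale B: hermitian_form "V_h P" "b_k P"
  by (rule hermitian_form.hermitian_form_subspace[OF hermitian_form_b_on[OF \<Omega> Omega_lebesgue order_refl] function_space_V_h])
    (use V_hD in blast)

lemma form_norm_eq: "B.form_norm v = energy_norm P v"
  by (simp add: B.form_norm_def energy_norm_on_def)

lemma V_h_AE_zero:
  assumes "v \<in> V_h P" "AE x in lebesgue. x \<in> Omega P \<longrightarrow> v x = 0"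
  shows "v = (\<lambda>_. 0)"
proof
  fix x
  have "v y = 0" if "y \<in> Omega P" for y
    using AE_zero_imp_zero[OF open_Omega _ assms(2) that]
      continuous_on_subset[OF V_hD(4)[OF assms(1)] closure_subset] by blast
  then have "v x = 0" if "x \<in> closure (Omega P)"
    using continuous_constant_on_closure[OF V_hD(4)[OF assms(1)]] that by blast
  then show "v x = 0" using V_hD(3)[OF assms(1)] unfolding P1_def by blast
qed

lemma energy_definite:
  assumes "v \<in> V_h P" "b_k P v v = 0"
  shows "v = (\<lambda>_. 0)"
proof (rule V_h_AE_zero[OF assms(1)])
  have "energy_norm P v = 0" using assms(2) by (simp add: energy_norm_on_def)
  then have 1: "(LINT x:Omega P|lebesgue. (\<Sum>i\<in>UNIV. (cmod (weak_grad (Omega P) v x $ i))\<^sup>2))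
     + (wavenumber P)\<^sup>2 * (LINT x:Omega P|lebesgue. (cmod (v x))\<^sup>2) = 0"
    using energy_norm_on_eq_integral[of P "Omega P" v] by simp
  have 2: "0 \<le> (LINT x:Omega P|lebesgue. (\<Sum>i\<in>UNIV. (cmod (weak_grad (Omega P) v x $ i))\<^sup>2))"
    "0 \<le> (wavenumber P)\<^sup>2 * (LINT x:Omega P|lebesgue. (cmod (v x))\<^sup>2)"
    by (simp_all add: set_lebesgue_integral_def sum_nonneg)
  have "(wavenumber P)\<^sup>2 * (LINT x:Omega P|lebesgue. (cmod (v x))\<^sup>2) = 0" using 1 2 by linarith
  then have "(LINT x:Omega P|lebesgue. (cmod (v x))\<^sup>2) = 0" using wavenumber_pos by simp
  then have "L2_inner (Omega P) v v = 0"
    unfolding L2_inner_def complex_norm_square[symmetric] set_integral_complex_of_real by simp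
  moreover have "square_integrable_on v (Omega P)" using V_hD(2)[OF assms(1)] by (simp add: H1_def)
  ultimately show "AE x in lebesgue. x \<in> Omega P \<longrightarrow> v x = 0" by (intro square_integral_zero_imp_AE)
qed

text \<open>
  A function in \<open>W_loc P z\<close> is determined by its values at the finitely many fine nodes.
\<close>

lemma xi_representer:
  assumes G: "antilinear_on (V_h P) G"
  shows "xi P G z \<in> W_loc P z" and "w \<in> W_loc P z \<Longrightarrow> b_k P (xi P G z) w = G w"
proof -
  interpret L: hermitian_form "W_loc P z" "b_k P"
    by (rule B.hermitian_form_subspace[OF function_space_W_loc W_loc_subset(3)])
  have definite: "v = (\<lambda>_. 0)" if "v \<in> W_loc P z" "b_k P v v = 0" for v
    using energy_definite that W_loc_subset by blast
  have determining: "v = (\<lambda>_. 0)" if "v \<in> W_loc P z" "\<forall>x\<in>nodes (fine_mesh P). v x = 0" for v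
    using P1_zero_at_nodes_imp_zero[OF fine_mesh _ that(2)] V_hD(3) that(1) W_loc_subset by blast
  have "\<exists>\<xi>\<in>W_loc P z. \<forall>w\<in>W_loc P z. b_k P \<xi> w = G w"
    by (rule finite_dimensional_Riesz[OF finite_nodes[OF fine_mesh] L.hermitian_form_axioms _ _
          antilinear_on_subset[OF G W_loc_subset(3)]])
      (erule (1) determining, erule (1) definite)
  then have ex: "\<exists>\<xi>. \<xi> \<in> W_loc P z \<and> (\<forall>w\<in>W_loc P z. b_k P \<xi> w = G w)" by blast
  have "\<exists>!\<xi>. \<xi> \<in> W_loc P z \<and> (\<forall>w\<in>W_loc P z. b_k P \<xi> w = G w)"
  proof (rule ex_ex1I[OF ex])
    fix u v assume uv: "u \<in> W_loc P z \<and> (\<forall>w\<in>W_loc P z. b_k P u w = G w)"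
      "v \<in> W_loc P z \<and> (\<forall>w\<in>W_loc P z. b_k P v w = G w)"
    show "u = v"
    proof (rule L.form_representer_unique)
      show "\<And>v. v \<in> W_loc P z \<Longrightarrow> b_k P v v = 0 \<Longrightarrow> v = (\<lambda>_. 0)" by (erule (1) definite)
    qed (use uv in simp_all)
  qed
  from theI'[OF this] show "xi P G z \<in> W_loc P z" and "w \<in> W_loc P z \<Longrightarrow> b_k P (xi P G z) w = G w"
    unfolding xi_def by blast+
qed

section \<open>Equivalence of the dual norm and the indicator\<close>

lemma eta_eq_L2_set: "eta P G = L2_set (\<lambda>z. energy_norm P (xi P G z)) (nodes (coarse_mesh P))"
  by (simp add: eta_def L2_set_def)

lemma eta_nonneg: "0 \<le> eta P G"
  by (simp add: eta_eq_L2_set)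

text \<open>
  Testing \<open>G\<close> with the sum of the representers gives \<open>(eta P G)\<^sup>2\<close>, because each representer satisfies
  \<open>G \<xi> = b_k P \<xi> \<xi>\<close>, and the synthesis bound controls the norm of this sum by \<open>C_syn * eta P G\<close>.
\<close>

lemma indicator_lower_bound:
  assumes G: "antilinear_on (V_h P) G" and C: "0 < C_syn" "synthesis_constant P C_syn"
  shows "ennreal (inverse C_syn * eta P G) \<le> dual_norm P (W_h P) G"
proof (cases "eta P G = 0")
  case False
  then have eta_pos: "0 < eta P G" using eta_nonneg[of G] by linarith
  interpret W: function_space "W_h P" by (rule function_space_W_h)
  let ?N = "nodes (coarse_mesh P)"
  define s where "s = (\<lambda>x. \<Sum>z\<in>?N. xi P G z x)"
  note \<xi> = xi_representer[OF G]
  have \<xi>V: "xi P G z \<in> V_h P" for z using \<xi>(1) W_loc_subset by blast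
  have sW: "s \<in> W_h P" unfolding s_def using \<xi>(1) W_loc_subset(1) by (intro W.sum_mem) blast
  then have sV: "s \<in> V_h P" using W_loc_subset by blast
  have "G s = (\<Sum>z\<in>?N. G (xi P G z))" unfolding s_def by (rule B.antilinear_on_sum[OF G \<xi>V])
  also have "\<dots> = (\<Sum>z\<in>?N. of_real ((energy_norm P (xi P G z))\<^sup>2))"
    unfolding form_norm_eq[symmetric] B.form_norm_square[OF \<xi>V, symmetric]
    by (intro sum.cong refl \<xi>(2)[symmetric] \<xi>(1))
  also have "\<dots> = of_real ((eta P G)\<^sup>2)" by (simp add: eta_def sum_nonneg)
  finally have Gs: "G s = of_real ((eta P G)\<^sup>2)" .
  have "s \<noteq> (\<lambda>_. 0)"
  proof
    assume "s = (\<lambda>_. 0)"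
    then have "G s = 0" using antilinear_onD(2)[OF G B.zero_mem, of 0] by simp
    then show False using Gs eta_pos by simp
  qed
  then have nz: "nonzero P s" "b_k P s s \<noteq> 0"
    using V_h_AE_zero[OF sV] energy_definite[OF sV] by (auto simp: nonzero_def)
  then have s_pos: "0 < energy_norm P s"
    using B.form_norm_square[OF sV] energy_norm_on_nonneg[of P "Omega P" s]
    unfolding form_norm_eq by (metis of_real_0 less_eq_real_def power_zero_numeral)
  have "(energy_norm P s)\<^sup>2 \<le> C_syn\<^sup>2 * (\<Sum>z\<in>?N. (energy_norm P (xi P G z))\<^sup>2)"
    using C(2) \<xi>(1) unfolding synthesis_constant_def s_def by blast
  also have "\<dots> = (C_syn * eta P G)\<^sup>2" by (simp add: eta_def power_mult_distrib sum_nonneg)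
  finally have "energy_norm P s \<le> C_syn * eta P G"
    using C(1) eta_nonneg by (intro power2_le_imp_le[of "energy_norm P s"]) simp_all
  then have "inverse C_syn * eta P G \<le> (eta P G)\<^sup>2 / energy_norm P s"
    using s_pos eta_pos C(1) by (simp add: field_simps power2_eq_square)
  also have "\<dots> = cmod (G s) / energy_norm P s" using Gs by (simp add: norm_power)
  finally have "ennreal (inverse C_syn * eta P G) \<le> ennreal (cmod (G s) / energy_norm P s)" by (rule ennreal_leI)
  also have "\<dots> \<le> dual_norm P (W_h P) G"
    unfolding dual_norm_def using sW nz by (intro SUP_upper) simp
  finally show ?thesis .
qed simp

text \<open>
  In a stable decomposition of \<open>w\<close> each local value of \<open>G\<close> is an energy product with a representer.
  Cauchy--Schwarz is applied in each local space and then to the sum over the vertices.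
\<close>

lemma indicator_upper_bound:
  assumes G: "antilinear_on (V_h P) G" and C: "0 \<le> C_sd" "stable_decomposition_constant P C_sd"
  shows "dual_norm P (W_h P) G \<le> ennreal (C_sd * eta P G)"
  unfolding dual_norm_def
proof (rule SUP_least)
  fix w assume w: "w \<in> {w \<in> W_h P. nonzero P w}"
  let ?N = "nodes (coarse_mesh P)"
  obtain w' where w': "\<And>z. z \<in> ?N \<Longrightarrow> w' z \<in> W_loc P z" "w = (\<lambda>x. \<Sum>z\<in>?N. w' z x)"
    "(\<Sum>z\<in>?N. (energy_norm P (w' z))\<^sup>2) \<le> C_sd\<^sup>2 * (energy_norm P w)\<^sup>2"
    using C(2) w unfolding stable_decomposition_constant_def by blast
  have wV: "w' z \<in> V_h P" if "z \<in> ?N" for z using w'(1)[OF that] W_loc_subset by blast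
  note \<xi> = xi_representer[OF G]
  have \<xi>V: "xi P G z \<in> V_h P" for z using \<xi>(1) W_loc_subset by blast
  have "G w = (\<Sum>z\<in>?N. G (w' z))"
    unfolding w'(2) by (rule B.antilinear_on_sum[OF G wV])
  also have "\<dots> = (\<Sum>z\<in>?N. b_k P (xi P G z) (w' z))"
    by (intro sum.cong refl \<xi>(2)[symmetric] w'(1))
  finally have "cmod (G w) \<le> (\<Sum>z\<in>?N. cmod (b_k P (xi P G z) (w' z)))" by (simp add: norm_sum)
  also have "\<dots> \<le> (\<Sum>z\<in>?N. \<bar>energy_norm P (xi P G z)\<bar> * \<bar>energy_norm P (w' z)\<bar>)"
    using B.Cauchy_Schwarz[OF \<xi>V wV] energy_norm_on_nonneg by (intro sum_mono) (simp add: form_norm_eq)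
  also have "\<dots> \<le> eta P G * L2_set (\<lambda>z. energy_norm P (w' z)) ?N"
    unfolding eta_eq_L2_set by (rule L2_set_mult_ineq)
  also have "L2_set (\<lambda>z. energy_norm P (w' z)) ?N \<le> C_sd * energy_norm P w"
    unfolding L2_set_def using w'(3) C(1) energy_norm_on_nonneg
    by (intro real_le_lsqrt) (simp_all add: power_mult_distrib)
  finally have "cmod (G w) \<le> eta P G * (C_sd * energy_norm P w)"
    using eta_nonneg by (simp add: mult_left_mono)
  then have "cmod (G w) / energy_norm P w \<le> C_sd * eta P G"
    using energy_norm_on_nonneg[of P "Omega P" w] C(1) eta_nonneg[of G]
    by (cases "energy_norm P w = 0") (simp_all add: pos_divide_le_eq algebra_simps)
  then show "ennreal (cmod (G w) / energy_norm P w) \<le> ennreal (C_sd * eta P G)" by (rule ennreal_leI)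
qed

section \<open>The residual\<close>

lemma hermitian_form_V_h_parts:
  "hermitian_form (V_h P) (grad_inner P (Omega P))" "hermitian_form (V_h P) (L2_inner (Omega P))"
  "hermitian_form (V_h P) (boundary_inner P (Gamma_R P \<inter> closure (Omega P)))"
proof -
  have V: "V_h P \<subseteq> H1 (Omega P)" using V_hD by blast
  show "hermitian_form (V_h P) (grad_inner P (Omega P))"
    by (rule hermitian_form.hermitian_form_subspace[OF hermitian_form_grad[OF \<Omega> Omega_lebesgue order_refl]
          function_space_V_h V])
  show "hermitian_form (V_h P) (L2_inner (Omega P))"
    by (rule hermitian_form_L2[OF function_space_V_h]) (use V in \<open>auto simp: H1_def\<close>)
  have "emeasure arc_measure (Gamma_R P \<inter> closure (Omega P)) < \<infinity>"
    by (rule arc_measure_polygonal_finite[OF polygonal]) (use Gamma_R in blast)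
  then show "hermitian_form (V_h P) (boundary_inner P (Gamma_R P \<inter> closure (Omega P)))"
    by (rule hermitian_form_boundary[OF \<Omega> _ _ _ function_space_V_h V_hD(4) refl, rotated 2])
      (use Gamma_R in auto)
qed

lemma a_k_sesquilinear:
  shows "u \<in> V_h P \<Longrightarrow> antilinear_on (V_h P) (a_k P u)"
    and "\<lbrakk>u \<in> V_h P; v \<in> V_h P; w \<in> V_h P\<rbrakk> \<Longrightarrow> a_k P (\<lambda>x. u x - v x) w = a_k P u w - a_k P v w"
proof -
  interpret G: hermitian_form "V_h P" "grad_inner P (Omega P)" by (rule hermitian_form_V_h_parts)
  interpret L: hermitian_form "V_h P" "L2_inner (Omega P)" by (rule hermitian_form_V_h_parts)
  interpret R: hermitian_form "V_h P" "boundary_inner P (Gamma_R P \<inter> closure (Omega P))"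
    by (rule hermitian_form_V_h_parts)
  show "antilinear_on (V_h P) (a_k P u)" if "u \<in> V_h P"
    using G.form_antilinear[OF that] L.form_antilinear[OF that] R.form_antilinear[OF that]
    unfolding antilinear_on_def a_on_def by (simp add: algebra_simps)
  assume u: "u \<in> V_h P" and v: "v \<in> V_h P" and w: "w \<in> V_h P"
  have minus: "b (\<lambda>x. u x - v x) w = b u w - b v w" if "hermitian_form (V_h P) b" for b
  proof -
    interpret b: hermitian_form "V_h P" b by fact
    show ?thesis
      using b.form_add[OF u B.scale_mem[OF v, of "-1"] w] b.form_scale[OF v w, of "-1"] by simp
  qed
  show "a_k P (\<lambda>x. u x - v x) w = a_k P u w - a_k P v w"
    unfolding a_on_def minus[OF hermitian_form_V_h_parts(1)] minus[OF hermitian_form_V_h_parts(2)]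
      minus[OF hermitian_form_V_h_parts(3)] by (simp add: algebra_simps)
qed

text \<open>
  The Galerkin equations replace the load by \<open>a_k P u\<close> on \<open>V_h P\<close>.
\<close>

lemma residual_eq:
  assumes "galerkin_solution P F u" "U \<in> V_h P" "w \<in> V_h P"
  shows "residual P F U w = a_k P (\<lambda>x. u x - U x) w"
  using assms a_k_sesquilinear(2)[of u U w] by (simp add: residual_def galerkin_solution_def)

lemma residual_antilinear:
  assumes "galerkin_solution P F u" "U \<in> V_h P"
  shows "antilinear_on (V_h P) (residual P F U)"
proof -
  have "(\<lambda>x. u x - U x) \<in> V_h P" using assms B.diff_mem by (simp add: galerkin_solution_def)
  from a_k_sesquilinear(1)[OF this] show ?thesis
    unfolding antilinear_on_def using residual_eq[OF assms] B.add_mem B.scale_mem by simp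
qed

text \<open>
  The constant itself may be negative if the local energy vanishes on all of \<open>V P\<close>, but the product is not.
\<close>

lemma continuity_constant_nonneg:
  assumes "continuity_constant_on P D C" "v \<in> V P"
  shows "0 \<le> C * energy_norm_on P D v"
proof (cases "energy_norm_on P D v = 0")
  case False
  then have "0 < energy_norm_on P D v" using energy_norm_on_nonneg[of P D v] by linarith
  moreover have "0 \<le> C * energy_norm_on P D v * energy_norm_on P D v"
    using assms norm_ge_zero[of "a_on P D v v"] unfolding continuity_constant_on_def by (meson order_trans)
  ultimately show ?thesis by (simp add: zero_le_mult_iff)
qed simp

text \<open>
  Continuity of the form bounds the dual norm of the residual, and the lower bound for the dual norm transfers
  this to the indicator.
\<close>

lemma global_efficiency:
  assumes u: "galerkin_solution P F u" and U: "U \<in> V_h P"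
    and C: "continuity_constant_on P (Omega P) C_a" "0 < C_syn" "synthesis_constant P C_syn"
  shows "eta_H P F U \<le> C_a * C_syn * energy_norm P (\<lambda>x. u x - U x)"
proof -
  let ?e = "\<lambda>x. u x - U x" and ?R = "residual P F U"
  have e: "?e \<in> V_h P" using u U B.diff_mem by (simp add: galerkin_solution_def)
  have nonneg: "0 \<le> C_a * energy_norm P ?e" by (rule continuity_constant_nonneg[OF C(1) V_hD(1)[OF e]])
  have "dual_norm P (W_h P) ?R \<le> ennreal (C_a * energy_norm P ?e)"
    unfolding dual_norm_def
  proof (intro SUP_least ennreal_leI)
    fix w assume "w \<in> {w \<in> W_h P. nonzero P w}"
    then have w: "w \<in> V_h P" using W_loc_subset by blast
    have "cmod (?R w) \<le> C_a * energy_norm P ?e * energy_norm P w"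
      using C(1) V_hD(1)[OF e] V_hD(1)[OF w] unfolding residual_eq[OF u U w] continuity_constant_on_def by blast
    then show "cmod (?R w) / energy_norm P w \<le> C_a * energy_norm P ?e"
      using energy_norm_on_nonneg[of P "Omega P" w] nonneg
      by (cases "energy_norm P w = 0") (simp_all add: pos_divide_le_eq)
  qed
  with indicator_lower_bound[OF residual_antilinear[OF u U] C(2,3)]
  have "ennreal (inverse C_syn * eta P ?R) \<le> ennreal (C_a * energy_norm P ?e)" by (rule order_trans)
  then have "inverse C_syn * eta P ?R \<le> C_a * energy_norm P ?e" using nonneg by (simp add: ennreal_le_iff)
  then show ?thesis using C(2) by (simp add: eta_H_def field_simps)
qed

section \<open>Locality\<close>

text \<open>
  A patch is a finite union of open triangles and so omits the edges between its elements; these lie in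
  frontiers of convex sets, which are negligible.
\<close>

lemma patch_properties:
  fixes z :: point
  defines "D \<equiv> patch (coarse_mesh P) 2 {z}"
  shows "open D" "D \<subseteq> Omega P" "AE x in lebesgue. x \<in> closure D \<longrightarrow> x \<in> D"
proof -
  define \<K> where "\<K> = {T \<in> coarse_mesh P. closure T \<inter> closure (neighbourhood (coarse_mesh P) {z}) \<noteq> {}}"
  have D: "D = \<Union>\<K>"
    by (simp add: D_def patch_def numeral_2_eq_2 neighbourhood_def[of _ "neighbourhood _ _"] \<K>_def)
  have sub: "T \<in> coarse_mesh P" if "T \<in> \<K>" for T using that by (simp add: \<K>_def)
  have fin: "finite \<K>" using coarse_mesh by (simp add: \<K>_def conforming_mesh_def)
  show "open D" "D \<subseteq> Omega P" unfolding D using coarse_element sub by blast+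
  have "closure D - D \<subseteq> (\<Union>T\<in>\<K>. frontier T)"
  proof
    fix x assume x: "x \<in> closure D - D"
    have "closed (\<Union>T\<in>\<K>. closure T)" using fin by (intro closed_UN) auto
    then have "closure D \<subseteq> (\<Union>T\<in>\<K>. closure T)"
      unfolding D using closure_subset by (intro closure_minimal) blast+
    then obtain T where "T \<in> \<K>" "x \<in> closure T" using x by blast
    moreover from this have "x \<notin> interior T" using x interior_subset[of T] by (auto simp: D)
    ultimately show "x \<in> (\<Union>T\<in>\<K>. frontier T)" by (auto simp: frontier_def)
  qed
  moreover have "negligible (\<Union>T\<in>\<K>. frontier T)"
    using fin sub coarse_element(3) by (intro negligible_Union) (auto intro: negligible_convex_frontier)
  ultimately have "closure D - D \<in> null_sets lebesgue"
    using negligible_subset negligible_iff_null_sets by blast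
  from AE_not_in[OF this] show "AE x in lebesgue. x \<in> closure D \<longrightarrow> x \<in> D" by eventually_elim simp
qed

lemma set_LINT_support:
  fixes f :: "point \<Rightarrow> complex"
  assumes f: "set_integrable lebesgue E f" and D: "D \<in> sets lebesgue" "D \<subseteq> E"
    and zero: "AE x in lebesgue. x \<in> E - D \<longrightarrow> f x = 0"
  shows "(LINT x:E|lebesgue. f x) = (LINT x:D|lebesgue. f x)"
  unfolding set_lebesgue_integral_def
proof (rule integral_cong_AE)
  show "(\<lambda>x. indicat_real E x *\<^sub>R f x) \<in> borel_measurable lebesgue"
    "(\<lambda>x. indicat_real D x *\<^sub>R f x) \<in> borel_measurable lebesgue"
    using f set_integrable_subset[OF f D] by (simp_all add: set_integrable_def)
  show "AE x in lebesgue. indicat_real E x *\<^sub>R f x = indicat_real D x *\<^sub>R f x"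
    using zero by eventually_elim (use D(2) in \<open>auto simp: indicator_def\<close>)
qed

text \<open>
  Outside the closed patch the function \<open>w\<close> vanishes, hence so do its weak gradient (almost everywhere)
  and its trace.
\<close>

lemma a_k_local:
  assumes v: "v \<in> V_h P" and w: "w \<in> W_loc P z"
  shows "a_k P v w = a_on P (patch (coarse_mesh P) 2 {z}) v w"
proof -
  define D where "D = patch (coarse_mesh P) 2 {z}"
  have D: "open D" "D \<subseteq> Omega P" and bd: "AE x in lebesgue. x \<in> closure D \<longrightarrow> x \<in> D"
    unfolding D_def by (rule patch_properties)+
  have Dl: "D \<in> sets lebesgue" using D(1) by simp
  have wV: "w \<in> V_h P" using w W_loc_subset by blast
  have w0: "w x = 0" if "x \<notin> closure D" for x using W_locD[OF w] that by (simp add: D_def)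
  have "AE x in lebesgue. x \<in> Omega P - closure D \<longrightarrow> weak_grad (Omega P) w x = 0"
    by (rule weak_grad_zero_on_open[OF \<Omega> _ _ V_hD(2)[OF wV]]) (use w0 open_Omega in auto)
  with bd have zero: "AE x in lebesgue. x \<in> Omega P - D \<longrightarrow> w x = 0 \<and> weak_grad (Omega P) w x = 0"
    by eventually_elim (use w0 in auto)
  have "grad_inner P (Omega P) v w = grad_inner P D v w"
    unfolding grad_inner_eq
  proof (rule set_LINT_support[OF _ Dl D(2)])
    show "set_integrable lebesgue (Omega P) (grad_dot (weak_grad (Omega P) v) (weak_grad (Omega P) w))"
      by (intro set_integrable_grad_dot weak_grad_square_integrable V_hD v wV Omega_lebesgue order_refl)
    show "AE x in lebesgue. x \<in> Omega P - D \<longrightarrow> grad_dot (weak_grad (Omega P) v) (weak_grad (Omega P) w) x = 0"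
      using zero by eventually_elim (simp add: grad_dot_def)
  qed
  moreover have "L2_inner (Omega P) v w = L2_inner D v w"
    unfolding L2_inner_def
  proof (rule set_LINT_support[OF _ Dl D(2)])
    show "set_integrable lebesgue (Omega P) (\<lambda>x. v x * cnj (w x))"
      using V_hD(2)[OF v] V_hD(2)[OF wV] by (intro square_integrable_mult_cnj) (simp_all add: H1_def)
    show "AE x in lebesgue. x \<in> Omega P - D \<longrightarrow> v x * cnj (w x) = 0"
      using zero by eventually_elim simp
  qed
  moreover have "boundary_inner P (Gamma_R P \<inter> closure (Omega P)) v w = boundary_inner P (Gamma_R P \<inter> closure D) v w"
    unfolding boundary_inner_def set_lebesgue_integral_def
  proof (intro Bochner_Integration.integral_cong refl)
    fix x
    show "indicat_real (Gamma_R P \<inter> closure (Omega P)) x *\<^sub>R (boundary_trace (Omega P) v x * cnj (boundary_trace (Omega P) w x))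
        = indicat_real (Gamma_R P \<inter> closure D) x *\<^sub>R (boundary_trace (Omega P) v x * cnj (boundary_trace (Omega P) w x))"
      using closure_mono[OF D(2)] trace_V_h[OF V_hD(3)[OF wV], of x] w0[of x] by (auto simp: indicator_def)
  qed
  ultimately show ?thesis by (simp add: a_on_def D_def)
qed

text \<open>
  The local representer is tested against itself in the residual equation. Its support lies in the
  patch, so the local continuity constant applies to the error restricted to the patch.
\<close>

lemma local_efficiency:
  assumes u: "galerkin_solution P F u" and U: "U \<in> V_h P"
    and C: "continuity_constant_on P (patch (coarse_mesh P) 2 {z}) C"
  shows "eta_H_loc P F z U \<le> C * energy_norm_on P (patch (coarse_mesh P) 2 {z}) (\<lambda>x. u x - U x)"
proof -
  let ?e = "\<lambda>x. u x - U x" and ?R = "residual P F U"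
  define D where "D = patch (coarse_mesh P) 2 {z}"
  define \<xi> where "\<xi> = xi P ?R z"
  note C = C[folded D_def]
  have e: "?e \<in> V_h P" using u U B.diff_mem by (simp add: galerkin_solution_def)
  have nonneg: "0 \<le> C * energy_norm_on P D ?e" by (rule continuity_constant_nonneg[OF C V_hD(1)[OF e]])
  have \<xi>: "\<xi> \<in> W_loc P z" "b_k P \<xi> \<xi> = ?R \<xi>"
    unfolding \<xi>_def using xi_representer[OF residual_antilinear[OF u U]] by blast+
  then have \<xi>V: "\<xi> \<in> V_h P" using W_loc_subset by blast
  have "of_real ((energy_norm P \<xi>)\<^sup>2) = a_on P D ?e \<xi>"
    using B.form_norm_square[OF \<xi>V] \<xi>(2) residual_eq[OF u U \<xi>V] a_k_local[OF e \<xi>(1)]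
    by (simp add: form_norm_eq D_def)
  then have "(energy_norm P \<xi>)\<^sup>2 = cmod (a_on P D ?e \<xi>)"
    by (metis norm_of_real abs_power2)
  also have "\<dots> \<le> C * energy_norm_on P D ?e * energy_norm_on P D \<xi>"
    using C V_hD(1)[OF e] V_hD(1)[OF \<xi>V] unfolding continuity_constant_on_def by blast
  also have "\<dots> \<le> C * energy_norm_on P D ?e * energy_norm P \<xi>"
    using patch_properties(1,2)[of z] V_hD(2)[OF \<xi>V] nonneg
    by (intro mult_left_mono energy_norm_on_mono Omega_lebesgue) (simp_all add: D_def)
  finally have "energy_norm P \<xi> * energy_norm P \<xi> \<le> C * energy_norm_on P D ?e * energy_norm P \<xi>"
    by (simp add: power2_eq_square)
  then have "energy_norm P \<xi> \<le> C * energy_norm_on P D ?e"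
    using energy_norm_on_nonneg[of P "Omega P" \<xi>] nonneg
    by (cases "energy_norm P \<xi> = 0") simp_all
  then show ?thesis by (simp add: eta_H_loc_def \<xi>_def D_def)
qed

end

theorem theorem3p2:
  fixes P :: helmholtz_problem
    and k_min \<sigma>\<^sub>H \<sigma>\<^sub>h C_a C_app C_sd C_syn \<chi>\<^sub>0 :: real
    and C_loc :: "point \<Rightarrow> real"
  assumes "helmholtz_setting P k_min \<sigma>\<^sub>H \<sigma>\<^sub>h"
    and "continuity_constant_on P (Omega P) C_a"
    and "\<forall>z\<in>nodes (coarse_mesh P). continuity_constant_on P (patch (coarse_mesh P) 2 {z}) (C_loc z)"
    and "approximation_constant P C_app"
    and "0 \<le> C_sd" and "stable_decomposition_constant P C_sd"
    and "0 < C_syn" and "synthesis_constant P C_syn"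
    and "chi_res P C_app \<le> \<chi>\<^sub>0" and "\<chi>\<^sub>0 < 1"
    and "inf_sup_constant P > 0"
  shows "(\<forall>G\<in>antidual P (V_h P).
            ennreal (inverse C_syn * eta P G) \<le> dual_norm P (W_h P) G \<and>
            dual_norm P (W_h P) G \<le> ennreal (C_sd * eta P G)) \<and>
         (\<forall>F\<in>antidual P (V P). \<forall>u\<^sub>h. galerkin_solution P F u\<^sub>h \<longrightarrow>
            (\<forall>U\<in>V_h P. eta_H P F U \<le> C_a * C_syn * energy_norm P (\<lambda>x. u\<^sub>h x - U x)) \<and>
            (\<forall>z\<in>nodes (coarse_mesh P). \<forall>U\<in>V_h P.
               eta_H_loc P F z U
                 \<le> C_loc z * energy_norm_on P (patch (coarse_mesh P) 2 {z}) (\<lambda>x. u\<^sub>h x - U x)))"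
proof -
  interpret helmholtz P k_min \<sigma>\<^sub>H \<sigma>\<^sub>h by unfold_locales (rule assms(1))
  have anti: "antilinear_on (V_h P) G" if "G \<in> antidual P (V_h P)" for G
    using that by (simp add: antidual_def antilinear_on_def)
  show ?thesis
  proof (intro conjI ballI allI impI)
    fix G assume "G \<in> antidual P (V_h P)"
    then show "ennreal (inverse C_syn * eta P G) \<le> dual_norm P (W_h P) G"
      and "dual_norm P (W_h P) G \<le> ennreal (C_sd * eta P G)"
      using indicator_lower_bound[OF anti assms(7,8)] indicator_upper_bound[OF anti assms(5,6)] by blast+
  next
    fix F u\<^sub>h U assume "galerkin_solution P F u\<^sub>h" "U \<in> V_h P"
    then show "eta_H P F U \<le> C_a * C_syn * energy_norm P (\<lambda>x. u\<^sub>h x - U x)"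
      by (rule global_efficiency[OF _ _ assms(2,7,8)])
  next
    fix F u\<^sub>h z U assume "galerkin_solution P F u\<^sub>h" "z \<in> nodes (coarse_mesh P)" "U \<in> V_h P"
    then show "eta_H_loc P F z U \<le> C_loc z * energy_norm_on P (patch (coarse_mesh P) 2 {z}) (\<lambda>x. u\<^sub>h x - U x)"
      using assms(3) by (intro local_efficiency) blast+
  qed
qed

end
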